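(* There exist absolute constants $c>0$ and $k_0$ such that for every $k\ge k_0$ and every bivariate polynomial $f(x,y)\in\mathbb{C}[x,y]$ whose Newton polytope $\mathrm{Newt}(f)$ has exactly $k$ vertices, there exists $a\in\mathbb{C}\setminus\{0\}$ such that the univariate polynomial $f(x,a)$ satisfies $B(f(x,a))\ge c\sqrt k$.
   Context: For $f(x,y)=\sum_{i,j}a_{i,j}x^iy^j$, $\mathrm{supp}(f):=\{(i,j):a_{i,j}\ne0\}$ and $\mathrm{Newt}(f)\subseteq\mathbb{R}^2$ is the convex hull of $\mathrm{supp}(f)$. For a univariate complex polynomial $g$ with non-zero roots $r_1e^{\imath\phi_1},\dots,r_ne^{\imath\phi_n}$ (listed with multiplicity, $r_i>0$, $\phi_i\in[0,2\pi)$), the bias is $$B(g):=\sup_{0\le\alpha\le\beta\le2\pi}\Big|N_{\alpha,\beta}(g)-\frac{n(\beta-\alpha)}{2\pi}\Big|,$$ where $N_{\alpha,\beta}(g)$ is the number of these roots (with multiplicity) with $\phi_i\in[\alpha,\beta]$. *)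

theory Defs
  imports "HOL-Analysis.Analysis" "HOL-Computational_Algebra.Polynomial"
begin

text \<open>A bivariate polynomial f(x,y) = sum a_{i,j} x^i y^j in C[x,y] is represented by
  its coefficient function F :: nat * nat => complex, required to have finite support.\<close>

definition supp2 :: "(nat \<times> nat \<Rightarrow> complex) \<Rightarrow> (nat \<times> nat) set" where
  "supp2 F = {p. F p \<noteq> 0}"

definition is_bipoly :: "(nat \<times> nat \<Rightarrow> complex) \<Rightarrow> bool" where
  "is_bipoly F \<longleftrightarrow> finite (supp2 F)"

definition newt :: "(nat \<times> nat \<Rightarrow> complex) \<Rightarrow> (real \<times> real) set" where
  "newt F = convex hull ((\<lambda>(i, j). (real i, real j)) ` supp2 F)"

definition num_vertices :: "(real \<times> real) set \<Rightarrow> nat" where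
  "num_vertices P = card {v. v extreme_point_of P}"

definition spec_y :: "(nat \<times> nat \<Rightarrow> complex) \<Rightarrow> complex \<Rightarrow> complex poly" where
  "spec_y F a = (\<Sum>p\<in>supp2 F. monom (F p * a ^ snd p) (fst p))"

definition arg02pi :: "complex \<Rightarrow> real" where
  "arg02pi z = (if Arg z < 0 then Arg z + 2 * pi else Arg z)"

definition nonzero_roots :: "complex poly \<Rightarrow> complex set" where
  "nonzero_roots g = {z. z \<noteq> 0 \<and> poly g z = 0}"

definition nz_root_count :: "complex poly \<Rightarrow> nat" where
  "nz_root_count g = (\<Sum>z\<in>nonzero_roots g. order z g)"

definition N_arg :: "real \<Rightarrow> real \<Rightarrow> complex poly \<Rightarrow> nat" where
  "N_arg \<alpha> \<beta> g = (\<Sum>z\<in>{z\<in>nonzero_roots g. \<alpha> \<le> arg02pi z \<and> arg02pi z \<le> \<beta>}. order z g)"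

definition bias :: "complex poly \<Rightarrow> real" where
  "bias g = (SUP ab\<in>{(\<alpha>, \<beta>). 0 \<le> \<alpha> \<and> \<alpha> \<le> \<beta> \<and> \<beta> \<le> 2 * pi}.
     \<bar>real (N_arg (fst ab) (snd ab) g) - real (nz_root_count g) * (snd ab - fst ab) / (2 * pi)\<bar>)"

end

theory Submission
  imports Defs "HOL-Complex_Analysis.Complex_Analysis"
    "HOL-Computational_Algebra.Fundamental_Theorem_Algebra" "HOL-Number_Theory.Cong"
begin

text \<open>
  One of the lower and the upper boundary of the Newton polygon has about \<open>k / 2\<close> edges; by symmetry take
  the lower one. As \<open>a \<rightarrow> 0\<close> the nonzero roots of \<open>f(x, a)\<close> split into groups, one per edge: the group of
  an edge of slope \<open>- e\<close> consists of approximately \<open>a\<^sup>e t\<close>, where \<open>t\<close> runs over the nonzero roots of the edge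
  polynomial. Turning \<open>a\<close> rotates different groups with different speeds, so on average over the
  argument of \<open>a\<close> their (centred) discrepancy functions are orthogonal and the variances add up.
  A single group has integral masses, hence its discrepancy takes all values modulo 1 equally often
  and has variance bounded below. So some \<open>a\<close> has variance, and thus squared bias, of order at
  least \<open>k\<close>. The averages are taken over a grid of \<open>M\<close>-th roots of unity with \<open>M\<close> a large prime.
\<close>

section \<open>Discrepancy of rotating point sets on a cyclic grid\<close>

text \<open>A finite grid turns both averages, over the turn \<open>t\<close> and the cut
  \<open>j\<close>, into finite sums. Primality of \<open>M\<close> serves twice: differences of
  slopes are invertible modulo \<open>M\<close>, so cross terms between groups vanish exactly, and
  the size of a group is coprime to \<open>M\<close>, so its discrepancy cannot be nearly constant.
  The obstacle is that the actual roots are only close to their limits and might slip over an arc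
  boundary. The grid is therefore itself turned by a generic angle \<phi>: no limit root lies on a
  boundary, each nearby root stays in the arc of its limit, and the counts agree exactly. How small
  the parameter must be depends on its modulus only, so its argument can be chosen afterwards.
  Clusters are bounded only from below. No root is missed, because the edge widths add up to the
  width of the support, which bounds the number of nonzero roots. Slopes are rational in general.
  Putting \<open>a = b powi (\<sigma> * int Q)\<close> with a factorial \<open>Q\<close> makes them
  integral, so that \<open>b powi e\<close> is single-valued and turning \<open>b\<close> by one arc
  turns group \<open>e\<close> by exactly \<open>e\<close> arcs.\<close>

lemma periodic_mod:
  fixes g :: "nat \<Rightarrow> 'a"
  assumes "\<And>j. g (j + M) = g j"
  shows "g (j mod M) = g j"
proof -
  have "g (a + k * M) = g a" for a k
    by (induction k) (use assms in \<open>simp_all add: algebra_simps, metis add.assoc add.commute\<close>)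
  from this[of "j mod M" "j div M"] show ?thesis by simp
qed

text \<open>Multiplication by a unit modulo \<open>M\<close>, followed by a shift, permutes the
  residues.\<close>

lemma sum_periodic_affine:
  fixes g :: "nat \<Rightarrow> 'a :: comm_monoid_add"
  assumes per: "\<And>j. g (j + M) = g j" and cop: "coprime e M" and "M > 0"
  shows "(\<Sum>t<M. g (j + e * t)) = (\<Sum>t<M. g t)"
proof -
  have inj: "inj_on (\<lambda>t. (j + e * t) mod M) {..<M}"
  proof (rule inj_onI)
    fix x y assume xy: "x \<in> {..<M}" "y \<in> {..<M}" and "(j + e * x) mod M = (j + e * y) mod M"
    then have "[j + e * x = j + e * y] (mod M)" by (simp add: cong_def)
    then have "[x = y] (mod M)" using cop by (simp add: cong_add_lcancel_nat cong_mult_lcancel_nat)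
    then show "x = y" using xy by (simp add: cong_def)
  qed
  moreover have "(\<lambda>t. (j + e * t) mod M) ` {..<M} \<subseteq> {..<M}" using \<open>M > 0\<close> by auto
  ultimately have bij: "bij_betw (\<lambda>t. (j + e * t) mod M) {..<M} {..<M}"
    by (simp add: bij_betw_def endo_inj_surj)
  have "(\<Sum>t<M. g (j + e * t)) = (\<Sum>t<M. g ((j + e * t) mod M))"
    by (simp add: periodic_mod[of g, OF per])
  also have "\<dots> = (\<Sum>t<M. g t)"
    using sum.reindex_bij_betw[OF bij, of g] by simp
  finally show ?thesis .
qed

lemma sum_periodic_shift:
  fixes g :: "nat \<Rightarrow> 'a :: comm_monoid_add"
  assumes "\<And>j. g (j + M) = g j" and "M > 0"
  shows "(\<Sum>j<M. g (j + h)) = (\<Sum>j<M. g j)"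
  using sum_periodic_affine[of g M 1 h] assms by (simp add: add.commute)

text \<open>With \<open>c i\<close> points in arc \<open>i\<close>, this is the excess over
  equidistribution in the arcs below \<open>j\<close>. The index runs over all naturals, so that
  shifts need no reduction modulo \<open>M\<close>.\<close>

definition disc :: "nat \<Rightarrow> (nat \<Rightarrow> nat) \<Rightarrow> nat \<Rightarrow> real" where
  "disc M c j = real (\<Sum>i<j. c i) - real (\<Sum>i<M. c i) * real j / real M"

lemma disc_periodic:
  assumes "\<And>j. c (j + M) = c j" and "M > 0"
  shows "disc M c (j + M) = disc M c j"
proof -
  have "(\<Sum>i<j + M. c i) = (\<Sum>i<j. c i) + (\<Sum>i<M. c (i + j))"
    by (induction M) (auto simp: algebra_simps)
  also have "(\<Sum>i<M. c (i + j)) = (\<Sum>i<M. c i)" by (rule sum_periodic_shift) (use assms in auto)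
  finally show ?thesis using assms(2) by (simp add: disc_def field_simps)
qed

text \<open>Turning the point set only moves the starting arc: the discrepancy is translated and
  then renormalised to vanish at 0.\<close>

lemma disc_shift:
  assumes "\<And>j. c (j + M) = c j" and "M > 0"
  shows "disc M (\<lambda>i. c (i + h)) j = disc M c (j + h) - disc M c h"
proof -
  have "(\<Sum>i<j + h. c i) = (\<Sum>i<h. c i) + (\<Sum>i<j. c (i + h))"
    by (induction j) (auto simp: algebra_simps)
  moreover have "(\<Sum>i<M. c (i + h)) = (\<Sum>i<M. c i)" by (rule sum_periodic_shift) (use assms in auto)
  ultimately show ?thesis using assms(2) by (simp add: disc_def field_simps)
qed

definition mean :: "nat \<Rightarrow> (nat \<Rightarrow> real) \<Rightarrow> real" where
  "mean M g = (\<Sum>j<M. g j) / real M"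

text \<open>Shifting by \<open>h\<close> with \<open>n * h \<equiv> (M - 1) / 2\<close> modulo \<open>M\<close> changes the discrepancy by almost one
  half modulo 1, so the discrepancy cannot stay close to any constant.\<close>

lemma disc_variance:
  assumes per: "\<And>j. c (j + M) = c j" and M: "M \<ge> 3" "odd M"
    and cop: "coprime (\<Sum>i<M. c i) M"
  shows "(\<Sum>j<M. (disc M c j - x)\<^sup>2) \<ge> real M / 36"
proof -
  define n where "n = (\<Sum>i<M. c i)"
  define D where "D = disc M c"
  have M0: "M > 0" using M by simp
  have Dper: "D (j + M) = D j" for j unfolding D_def by (rule disc_periodic) (use per M0 in auto)
  obtain h0 where h0: "[n * h0 = 1] (mod M)" using cong_solve_coprime_nat cop n_def by auto
  define h where "h = h0 * ((M - 1) div 2)"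
  have "[n * h = (M - 1) div 2] (mod M)"
    using cong_mult[OF h0 cong_refl[of "(M - 1) div 2"]] by (simp add: h_def mult.assoc)
  then have "(n * h) mod M = (M - 1) div 2" using M by (simp add: cong_def)
  then have nh: "n * h = (n * h div M) * M + (M - 1) div 2" by (metis div_mult_mod_eq)
  define k where "k = n * h div M"
  obtain l where l: "M = 2 * l + 1" using M(2) by (auto elim: oddE)
  have half: "2 * real ((M - 1) div 2) = real M - 1" by (simp add: l)
  \<comment> \<open>The difference is an integer minus \<open>(M - 1) / (2 * M)\<close>. This
    fraction lies between 1/3 and 1/2 because \<open>M \<ge> 3\<close>, so its distance to every
    integer is at least 1/3.\<close>
  have step: "(D (j + h) - D j)\<^sup>2 \<ge> 1 / 9" for j
  proof -
    have "(\<Sum>i<j + h. c i) = (\<Sum>i<j. c i) + (\<Sum>i<h. c (i + j))"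
      by (induction h) (auto simp: algebra_simps)
    then have "D (j + h) - D j = real (\<Sum>i<h. c (i + j)) - real (n * h) / real M"
      by (simp add: D_def disc_def n_def[symmetric] add_divide_distrib algebra_simps)
    also have "real (n * h) / real M = real k + real ((M - 1) div 2) / real M"
      using nh M0 by (simp add: k_def field_simps flip: of_nat_mult of_nat_add)
    finally have eq: "D (j + h) - D j = of_int (int (\<Sum>i<h. c (i + j)) - int k) - real ((M - 1) div 2) / real M"
      by simp
    define f where "f = real ((M - 1) div 2) / real M"
    have f: "1 / 3 \<le> f" "f \<le> 1 / 2" using half M by (auto simp: f_def field_simps)
    define z where "z = int (\<Sum>i<h. c (i + j)) - int k"
    have "of_int z \<le> (0::real) \<or> of_int z \<ge> (1::real)"
      by (cases "z \<le> 0") auto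
    then have "\<bar>of_int z - f\<bar> \<ge> 1 / 3" using f by linarith
    then have "(of_int z - f)\<^sup>2 \<ge> (1 / 3)\<^sup>2" by (metis abs_le_square_iff abs_of_nonneg zero_le_divide_1_iff zero_le_numeral)
    then show ?thesis using eq by (simp add: f_def z_def power2_eq_square)
  qed
  \<comment> \<open>Comparing both values with \<open>x\<close> costs a factor 2, and the two
    resulting sums coincide by periodicity, which costs another 2: hence 36 in place of 9.\<close>
  have "real M / 9 = (\<Sum>j<M. 1 / 9)" by simp
  also have "\<dots> \<le> (\<Sum>j<M. (D (j + h) - D j)\<^sup>2)" by (rule sum_mono) (rule step)
  also have "\<dots> \<le> (\<Sum>j<M. 2 * (D (j + h) - x)\<^sup>2 + 2 * (D j - x)\<^sup>2)"
  proof (rule sum_mono)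
    fix j
    have "0 \<le> ((D (j + h) - x) + (D j - x))\<^sup>2" by simp
    then show "(D (j + h) - D j)\<^sup>2 \<le> 2 * (D (j + h) - x)\<^sup>2 + 2 * (D j - x)\<^sup>2"
      by (simp add: power2_eq_square algebra_simps)
  qed
  also have "\<dots> = 2 * (\<Sum>j<M. (D (j + h) - x)\<^sup>2) + 2 * (\<Sum>j<M. (D j - x)\<^sup>2)"
    by (simp add: sum.distrib sum_distrib_left)
  also have "(\<Sum>j<M. (D (j + h) - x)\<^sup>2) = (\<Sum>j<M. (D j - x)\<^sup>2)"
    by (rule sum_periodic_shift[of "\<lambda>j. (D j - x)\<^sup>2"]) (use Dper M0 in auto)
  finally show ?thesis by (simp add: D_def)
qed

text \<open>Orthogonality of different speeds: shifting \<open>j\<close> by \<open>d * t\<close>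
  leaves only the relative speed \<open>e - d\<close>, a unit modulo the prime \<open>M\<close>. For
  fixed \<open>j\<close> the argument of \<open>g\<close> then runs through all residues, and
  \<open>g\<close> sums to 0.\<close>

lemma sum_product_periodic_zero:
  fixes f g :: "nat \<Rightarrow> real"
  assumes "prime M" and f: "\<And>j. f (j + M) = f j" and g: "\<And>j. g (j + M) = g j"
    and "(\<Sum>j<M. f j) = 0" and "(\<Sum>j<M. g j) = 0"
    and "d < M" "e < M" "d \<noteq> e"
  shows "(\<Sum>t<M. \<Sum>j<M. f (j + d * t) * g (j + e * t)) = 0"
  using assms
proof (induction d e arbitrary: f g rule: linorder_wlog)
  case (le d e)
  have M0: "M > 0" using le.prems(1) prime_gt_0_nat by blast
  define k where "k = e - d"
  have e: "e = d + k" and k: "0 < k" "k < M" using le by (auto simp: k_def)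
  have cop: "coprime k M"
    using k le.prems(1) by (metis coprime_commute nat_dvd_not_less prime_imp_coprime_nat)
  have "(\<Sum>j<M. f (j + d * t) * g (j + e * t)) = (\<Sum>j<M. f j * g (j + k * t))" for t
  proof -
    have "(\<Sum>j<M. f (j + d * t) * g (j + e * t)) = (\<Sum>j<M. (\<lambda>i. f i * g (i + k * t)) (j + d * t))"
      by (simp add: e algebra_simps)
    also have "\<dots> = (\<Sum>j<M. f j * g (j + k * t))"
      by (rule sum_periodic_shift) (use M0 le.prems(2,3) in \<open>auto, metis add.assoc add.commute\<close>)
    finally show ?thesis .
  qed
  then have "(\<Sum>t<M. \<Sum>j<M. f (j + d * t) * g (j + e * t)) = (\<Sum>j<M. \<Sum>t<M. f j * g (j + k * t))"
    by (simp only:) (rule sum.swap)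
  also have "\<dots> = (\<Sum>j<M. f j * (\<Sum>t<M. g (j + k * t)))" by (simp add: sum_distrib_left)
  also have "\<dots> = 0" by (simp add: sum_periodic_affine[of g, OF le.prems(3) cop M0] le.prems)
  finally show ?case .
next
  case (sym e d)
  from sym.IH[of g f] sym.prems show ?case by (simp add: mult.commute)
qed

text \<open>A second moment argument: the mean of the squared discrepancy over all turns
  \<open>t\<close> and cuts \<open>j\<close> already reaches the bound, each group contributing at
  least 1/36.\<close>

lemma exists_large_discrepancy:
  fixes c :: "'i \<Rightarrow> nat \<Rightarrow> nat" and d :: "'i \<Rightarrow> nat"
  assumes I: "finite I" and M: "prime M" "M \<ge> 3"
    and per: "\<And>s j. s \<in> I \<Longrightarrow> c s (j + M) = c s j"
    and pos: "\<And>s. s \<in> I \<Longrightarrow> 0 < (\<Sum>i<M. c s i)"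
    and less: "\<And>s. s \<in> I \<Longrightarrow> (\<Sum>i<M. c s i) < M"
    and d: "inj_on d I" "\<And>s. s \<in> I \<Longrightarrow> d s < M"
  shows "\<exists>t<M. \<exists>j<M. (disc M (\<lambda>i. \<Sum>s\<in>I. c s (i + d s * t)) j)\<^sup>2 \<ge> real (card I) / 36"
proof (rule ccontr)
  assume contra: "\<not> ?thesis"
  have M0: "M > 0" and oddM: "odd M" using M prime_odd_nat by auto
  define g where "g s j = disc M (c s) j - mean M (disc M (c s))" for s j
  have gper: "g s (j + M) = g s j" if "s \<in> I" for s j
    using disc_periodic[of "c s" M] per[OF that] M0 by (simp add: g_def)
  have gsum: "(\<Sum>j<M. g s j) = 0" for s
    using M0 by (simp add: g_def sum_subtractf mean_def)
  have gvar: "(\<Sum>j<M. (g s j)\<^sup>2) \<ge> real M / 36" if "s \<in> I" for s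
    unfolding g_def
  proof (rule disc_variance)
    show "coprime (\<Sum>i<M. c s i) M"
      using pos[OF that] less[OF that] M(1) 
      by (metis coprime_commute nat_dvd_not_less prime_imp_coprime_nat)
  qed (use per[OF that] M oddM in auto)
  \<comment> \<open>\<open>X\<close> is the total discrepancy recentred to mean zero in
    \<open>j\<close>. It differs from \<open>disc\<close> only by the constant \<open>X t 0\<close>,
    since \<open>disc\<close> is normalised to vanish at 0.\<close>
  define X where "X t j = (\<Sum>s\<in>I. g s (j + d s * t))" for t j
  define C where "C t i = (\<Sum>s\<in>I. c s (i + d s * t))" for t i
  have disc_C: "disc M (C t) j = X t j - X t 0" for t j
  proof -
    have "disc M (C t) j = (\<Sum>s\<in>I. disc M (\<lambda>i. c s (i + d s * t)) j)"
      unfolding disc_def C_def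
      unfolding sum_subtractf sum.swap[of _ I]
      by (simp add: sum_divide_distrib sum_distrib_right)
    also have "\<dots> = (\<Sum>s\<in>I. g s (j + d s * t) - g s (d s * t))"
      by (rule sum.cong) (use disc_shift per M0 in \<open>auto simp: g_def\<close>)
    finally show ?thesis by (simp add: X_def sum_subtractf)
  qed
  have Xsum: "(\<Sum>j<M. X t j) = 0" for t
  proof -
    have "(\<Sum>j<M. X t j) = (\<Sum>s\<in>I. \<Sum>j<M. g s (j + d s * t))" unfolding X_def by (rule sum.swap)
    also have "\<dots> = (\<Sum>s\<in>I. \<Sum>j<M. g s j)"
      by (intro sum.cong refl sum_periodic_shift[of "g _"]) (use gper M0 in auto)
    finally show ?thesis by (simp add: gsum)
  qed
  \<comment> \<open>In the expanded square the terms with \<open>r \<noteq> s\<close> vanish,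
    because distinct groups have distinct speeds below \<open>M\<close>.\<close>
  have "(\<Sum>t<M. \<Sum>j<M. (X t j)\<^sup>2) = (\<Sum>t<M. \<Sum>j<M. \<Sum>s\<in>I. \<Sum>r\<in>I. g s (j + d s * t) * g r (j + d r * t))"
    by (simp add: X_def power2_eq_square sum_product)
  also have "\<dots> = (\<Sum>s\<in>I. \<Sum>r\<in>I. \<Sum>t<M. \<Sum>j<M. g s (j + d s * t) * g r (j + d r * t))"
    unfolding sum.swap[of _ I "{..<M}"] ..
  also have "\<dots> = (\<Sum>s\<in>I. \<Sum>r\<in>I. if r = s then \<Sum>t<M. \<Sum>j<M. (g s (j + d s * t))\<^sup>2 else 0)"
  proof (intro sum.cong refl)
    fix s r assume sr: "s \<in> I" "r \<in> I"
    show "(\<Sum>t<M. \<Sum>j<M. g s (j + d s * t) * g r (j + d r * t)) =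
      (if r = s then \<Sum>t<M. \<Sum>j<M. (g s (j + d s * t))\<^sup>2 else 0)"
    proof (cases "r = s")
      case False
      then have "d s \<noteq> d r" using d(1) sr by (auto dest: inj_onD)
      then show ?thesis using False sum_product_periodic_zero[OF M(1), of "g s" "g r" "d s" "d r"]
        gper[OF sr(1)] gper[OF sr(2)] gsum d(2) sr by auto
    qed (simp add: power2_eq_square)
  qed
  also have "\<dots> = (\<Sum>s\<in>I. \<Sum>t<M. \<Sum>j<M. (g s (j + d s * t))\<^sup>2)"
    using I by (simp add: sum.delta)
  also have "\<dots> = (\<Sum>s\<in>I. \<Sum>t<M. \<Sum>j<M. (g s j)\<^sup>2)"
    by (intro sum.cong refl sum_periodic_shift[of "\<lambda>j. (g _ j)\<^sup>2"]) (use gper M0 in auto)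
  also have "\<dots> \<ge> (\<Sum>s\<in>I. \<Sum>t<M. real M / 36)"
    by (intro sum_mono) (use gvar in auto)
  finally have lower: "real (card I) * real M * real M / 36 \<le> (\<Sum>t<M. \<Sum>j<M. (X t j)\<^sup>2)"
    by simp
  \<comment> \<open>Since \<open>X t\<close> has mean zero, subtracting a constant from it can only
    increase the second moment.\<close>
  have "(\<Sum>t<M. \<Sum>j<M. (X t j)\<^sup>2) \<le> (\<Sum>t<M. \<Sum>j<M. (disc M (C t) j)\<^sup>2)"
  proof (rule sum_mono)
    fix t
    have "(\<Sum>j<M. (disc M (C t) j)\<^sup>2) = (\<Sum>j<M. (X t j)\<^sup>2 - 2 * X t 0 * X t j + (X t 0)\<^sup>2)"
      by (simp add: disc_C power2_eq_square algebra_simps)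
    also have "\<dots> = (\<Sum>j<M. (X t j)\<^sup>2) - 2 * X t 0 * (\<Sum>j<M. X t j) + real M * (X t 0)\<^sup>2"
      by (simp add: sum.distrib sum_subtractf sum_distrib_left)
    finally show "(\<Sum>j<M. (X t j)\<^sup>2) \<le> (\<Sum>j<M. (disc M (C t) j)\<^sup>2)" by (simp add: Xsum)
  qed
  also have "\<dots> < (\<Sum>t<M. \<Sum>j<M. real (card I) / 36)"
    using contra M0 unfolding C_def[abs_def] by (intro sum_strict_mono) (auto simp: not_le)
  finally show False using lower by (simp add: algebra_simps)
qed

section \<open>Slopes of the lower boundary of a planar point set\<close>

text \<open>Under the substitution \<open>x = b\<^sup>e u\<close> a monomial \<open>b\<^sup>j x\<^sup>i\<close> becomes \<open>b\<^sup>w u\<^sup>i\<close> where \<open>w\<close> is the weight of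
  \<open>(i, j)\<close> for \<open>e\<close>. Heights are integers, not naturals, so that reflection turns the upper boundary
  into a lower one.\<close>

definition wt :: "int \<Rightarrow> nat \<times> int \<Rightarrow> int" where
  "wt e p = snd p + e * int (fst p)"

text \<open>The points on the lower supporting line of slope \<open>- e\<close>: a single vertex, or
  all points of \<open>S\<close> on an edge.\<close>

definition face :: "(nat \<times> int) set \<Rightarrow> int \<Rightarrow> (nat \<times> int) set" where
  "face S e = {p\<in>S. \<forall>q\<in>S. wt e p \<le> wt e q}"

definition slopes :: "(nat \<times> int) set \<Rightarrow> int set" where
  "slopes S = {e. \<exists>p\<in>face S e. \<exists>q\<in>face S e. fst p \<noteq> fst q}"

definition lo :: "(nat \<times> int) set \<Rightarrow> int \<Rightarrow> nat" where
  "lo S e = Min (fst ` face S e)"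

definition hi :: "(nat \<times> int) set \<Rightarrow> int \<Rightarrow> nat" where
  "hi S e = Max (fst ` face S e)"

text \<open>The \<open>e\<close> for which two points have equal weight. The division is exact for sets with integral
  slopes, which is achieved by multiplying all heights by a factorial.\<close>

definition cross :: "nat \<times> int \<Rightarrow> nat \<times> int \<Rightarrow> int" where
  "cross p q = (snd p - snd q) div (int (fst q) - int (fst p))"

definition integral_slopes :: "(nat \<times> int) set \<Rightarrow> bool" where
  "integral_slopes S \<longleftrightarrow> (\<forall>p\<in>S. \<forall>q\<in>S. fst p \<noteq> fst q \<longrightarrow> (int (fst q) - int (fst p)) dvd (snd p - snd q))"

lemma face_subset: "face S e \<subseteq> S"
  by (auto simp: face_def)

lemma face_nonempty:
  assumes "finite S" "S \<noteq> {}"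
  shows "face S e \<noteq> {}"
proof -
  have "Min (wt e ` S) \<in> wt e ` S" using assms by simp
  then obtain p where "p \<in> S" "wt e p = Min (wt e ` S)" by force
  then have "p \<in> face S e" using assms by (auto simp: face_def)
  then show ?thesis by auto
qed

lemma face_wt_eq: "p \<in> face S e \<Longrightarrow> q \<in> face S e \<Longrightarrow> wt e p = wt e q"
  by (auto simp: face_def intro: antisym)

lemma face_inj_on_fst: "inj_on fst (face S e)"
proof (rule inj_onI)
  fix p q assume "p \<in> face S e" "q \<in> face S e" "fst p = fst q"
  then show "p = q" using face_wt_eq[of p S e q] by (simp add: wt_def prod_eq_iff)
qed

lemma cross_eq_iff:
  assumes "(int (fst q) - int (fst p)) dvd (snd p - snd q)" "fst p \<noteq> fst q"
  shows "cross p q = e \<longleftrightarrow> wt e p = wt e q"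
proof -
  obtain k where k: "snd p - snd q = (int (fst q) - int (fst p)) * k" using assms by (auto elim: dvdE)
  have "cross p q = k" using assms k by (simp add: cross_def)
  moreover have "wt e p - wt e q = (int (fst q) - int (fst p)) * (k - e)"
    using k by (simp add: wt_def algebra_simps)
  ultimately show ?thesis using assms by auto
qed

lemma cross_le_iff:
  assumes "(int (fst q) - int (fst p)) dvd (snd p - snd q)" "fst p < fst q"
  shows "cross p q \<le> e \<longleftrightarrow> wt e p \<le> wt e q"
proof -
  obtain k where k: "snd p - snd q = (int (fst q) - int (fst p)) * k" using assms by (auto elim: dvdE)
  have "cross p q = k" using assms k by (simp add: cross_def)
  moreover have "wt e p - wt e q = (int (fst q) - int (fst p)) * (k - e)"
    using k by (simp add: wt_def algebra_simps)
  moreover have "int (fst q) - int (fst p) > 0" using assms by simp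
  ultimately show ?thesis by (smt (verit) mult_le_0_iff)
qed

lemma cross_commute: "cross p q = cross q p"
  unfolding cross_def by (metis minus_diff_eq div_minus_minus)

text \<open>Adding the two minimality inequalities cancels the heights. So faces move left as
  \<open>e\<close> grows, and different edges lie over disjoint intervals.\<close>

lemma face_left_of:
  assumes "e < e'" "p \<in> face S e" "q \<in> face S e'"
  shows "fst q \<le> fst p"
proof -
  have "wt e p \<le> wt e q" "wt e' q \<le> wt e' p" using assms by (auto simp: face_def)
  then have "(e' - e) * (int (fst q) - int (fst p)) \<le> 0" by (simp add: wt_def algebra_simps)
  then show ?thesis using assms(1) by (simp add: mult_le_0_iff)
qed

lemma finite_slopes:
  assumes "finite S" "integral_slopes S"
  shows "finite (slopes S)"
proof (rule finite_subset)
  show "slopes S \<subseteq> (\<lambda>(p, q). cross p q) ` (S \<times> S)"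
  proof
    fix e assume "e \<in> slopes S"
    then obtain p q where pq: "p \<in> face S e" "q \<in> face S e" "fst p \<noteq> fst q" by (auto simp: slopes_def)
    then have "p \<in> S" "q \<in> S" using face_subset by blast+
    moreover have "cross p q = e"
      using cross_eq_iff[of q p e] face_wt_eq[OF pq(1,2)] pq(3) assms(2) \<open>p \<in> S\<close> \<open>q \<in> S\<close>
      unfolding integral_slopes_def by blast
    ultimately show "e \<in> (\<lambda>(p, q). cross p q) ` (S \<times> S)" by force
  qed
qed (use assms in auto)

lemma lo_less_hi:
  assumes "finite S" "e \<in> slopes S"
  shows "lo S e < hi S e"
proof -
  obtain p q where pq: "p \<in> face S e" "q \<in> face S e" "fst p \<noteq> fst q" using assms by (auto simp: slopes_def)
  have fin: "finite (fst ` face S e)" using assms face_subset by (meson finite_imageI finite_subset)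
  have "lo S e \<le> fst p" "lo S e \<le> fst q" "fst p \<le> hi S e" "fst q \<le> hi S e"
    unfolding lo_def hi_def using fin pq by auto
  then show ?thesis using pq(3) by linarith
qed

lemma lo_hi_attained:
  assumes "finite S" "S \<noteq> {}"
  obtains p q where "p \<in> face S e" "fst p = lo S e" "q \<in> face S e" "fst q = hi S e"
proof -
  have "finite (fst ` face S e)" "fst ` face S e \<noteq> {}"
    using assms finite_subset[OF face_subset] face_nonempty by auto
  then have "lo S e \<in> fst ` face S e" "hi S e \<in> fst ` face S e" unfolding lo_def hi_def by auto
  then show ?thesis using that by force
qed

lemma lo_hi_bounds:
  assumes "finite S" "p \<in> face S e"
  shows "lo S e \<le> fst p" "fst p \<le> hi S e"
  using assms finite_subset[OF face_subset] unfolding lo_def hi_def by auto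

text \<open>The slope of the edge over \<open>[i, i + 1]\<close> is the minimax of the crossing slopes of a point to the
  left with a point to the right.\<close>

lemma slopes_cover:
  assumes S: "finite S" "integral_slopes S" and "p0 \<in> S" "fst p0 \<le> i" "q0 \<in> S" "i < fst q0"
  shows "\<exists>e\<in>slopes S. lo S e \<le> i \<and> i < hi S e"
proof -
  define A where "A = {p\<in>S. fst p \<le> i}"
  define B where "B = {p\<in>S. i < fst p}"
  have "p0 \<in> A" "q0 \<in> B" using assms by (auto simp: A_def B_def)
  moreover have "finite A" "finite B" using S(1) by (simp_all add: A_def B_def)
  ultimately have fin: "finite A" "finite B" "A \<noteq> {}" "B \<noteq> {}" by blast+
  have dv: "(int (fst q) - int (fst p)) dvd (snd p - snd q)" "fst p < fst q" if "p \<in> A" "q \<in> B" for p q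
    using that S(2) by (auto simp: A_def B_def integral_slopes_def)
  \<comment> \<open>\<open>m p\<close> is the least \<open>e\<close> for which \<open>p\<close>
    weighs no more than any point of \<open>B\<close>.\<close>
  define m where "m p = Max (cross p ` B)" for p
  define e where "e = Min (m ` A)"
  have "e \<in> m ` A" unfolding e_def using fin by simp
  then obtain p where p: "p \<in> A" "e = m p" by auto
  have "m p \<in> cross p ` B" unfolding m_def using fin by simp
  then obtain q where q: "q \<in> B" "e = cross p q" using p by auto
  have eq: "wt e p = wt e q" using cross_eq_iff[OF dv(1)[OF p(1) q(1)], of e] dv(2)[OF p(1) q(1)] q(2) by simp
  have pB: "wt e p \<le> wt e r" if "r \<in> B" for r
    using cross_le_iff[OF dv[OF p(1) that], of e] that fin p by (auto simp: m_def)
  \<comment> \<open>By minimality of \<open>e\<close>, some right point \<open>x\<close> weighs no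
    more than \<open>r\<close>, and no right point is lighter than \<open>p\<close>.\<close>
  have pA: "wt e p \<le> wt e r" if r: "r \<in> A" for r
  proof -
    have "m r \<in> cross r ` B" unfolding m_def using fin by simp
    then obtain x where x: "x \<in> B" "m r = cross r x" by auto
    have "e \<le> cross r x" unfolding e_def x(2)[symmetric] using r fin by auto
    then have "wt e x \<le> wt e r"
      using cross_le_iff[OF dv[OF r x(1)], of e] cross_eq_iff[of x r e] dv[OF r x(1)] by force
    then show ?thesis using pB[OF x(1)] by simp
  qed
  have "S = A \<union> B" by (auto simp: A_def B_def)
  then have "p \<in> face S e" "q \<in> face S e" using pA pB p(1) q(1) eq by (auto simp: face_def)
  moreover from this have "lo S e \<le> fst p" "fst q \<le> hi S e" using lo_hi_bounds S by auto
  moreover have "fst p \<le> i" "i < fst q" using p q by (auto simp: A_def B_def)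
  ultimately show ?thesis unfolding slopes_def by (intro bexI[of _ e]) force+
qed

text \<open>The half-open intervals from \<open>lo\<close> to \<open>hi\<close> partition the range
  of abscissae. This matches the roots found near the edges with the upper bound for all nonzero
  roots.\<close>

lemma sum_slopes_width:
  assumes S: "finite S" "S \<noteq> {}" "integral_slopes S"
  shows "(\<Sum>e\<in>slopes S. hi S e - lo S e) = Max (fst ` S) - Min (fst ` S)"
proof -
  have sub: "{lo S e..<hi S e} \<subseteq> {Min (fst ` S)..<Max (fst ` S)}" for e
  proof -
    obtain p q where "p \<in> face S e" "fst p = lo S e" "q \<in> face S e" "fst q = hi S e"
      using lo_hi_attained[OF S(1,2)] by blast
    then have "Min (fst ` S) \<le> lo S e" "hi S e \<le> Max (fst ` S)"
      using face_subset[of S e] S by (metis Min_le finite_imageI imageI subsetD)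
         (metis Max_ge S(1) face_subset finite_imageI imageI subsetD \<open>q \<in> face S e\<close> \<open>fst q = hi S e\<close>)
    then show ?thesis by auto
  qed
  have "{Min (fst ` S)..<Max (fst ` S)} = (\<Union>e\<in>slopes S. {lo S e..<hi S e})"
  proof (intro equalityI subsetI)
    fix i assume i: "i \<in> {Min (fst ` S)..<Max (fst ` S)}"
    have "Min (fst ` S) \<in> fst ` S" "Max (fst ` S) \<in> fst ` S" using S by auto
    then obtain p q where "p \<in> S" "q \<in> S" "fst p = Min (fst ` S)" "fst q = Max (fst ` S)" by force
    then show "i \<in> (\<Union>e\<in>slopes S. {lo S e..<hi S e})"
      using slopes_cover[OF S(1,3), of p i q] i by auto
  qed (use sub in blast)
  moreover have "card (\<Union>e\<in>slopes S. {lo S e..<hi S e}) = (\<Sum>e\<in>slopes S. card {lo S e..<hi S e})"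
  proof (rule card_UN_disjoint)
    have *: "{lo S e..<hi S e} \<inter> {lo S e'..<hi S e'} = {}" if "e < e'" for e e'
    proof -
      obtain p where "p \<in> face S e" "fst p = lo S e" using lo_hi_attained[OF S(1,2)] by blast
      moreover obtain q where "q \<in> face S e'" "fst q = hi S e'" using lo_hi_attained[OF S(1,2)] by blast
      ultimately show ?thesis using face_left_of[OF that] by fastforce
    qed
    show "\<forall>e\<in>slopes S. \<forall>e'\<in>slopes S. e \<noteq> e' \<longrightarrow> {lo S e..<hi S e} \<inter> {lo S e'..<hi S e'} = {}"
      using * by (metis Int_commute linorder_neqE)
  qed (use finite_slopes S in auto)
  ultimately show ?thesis by (metis (no_types, lifting) card_atLeastLessThan sum.cong)
qed

text \<open>The supporting slope is real even for integral point sets: between edges with parameters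
  \<open>e\<close> and \<open>e + 1\<close> no integer isolates the common vertex.\<close>

definition lower_vertices :: "(nat \<times> int) set \<Rightarrow> (nat \<times> int) set" where
  "lower_vertices S = {v\<in>S. \<exists>l::real. \<forall>q\<in>S - {v}.
     of_int (snd v) + l * real (fst v) < of_int (snd q) + l * real (fst q)}"

text \<open>Every lower vertex except the leftmost one is the right end of an edge.\<close>

lemma card_lower_vertices:
  assumes S: "finite S" "integral_slopes S"
  shows "card (lower_vertices S) \<le> card (slopes S) + 1"
proof -
  define L where "L v = {p\<in>S. fst p < fst v}" for v :: "nat \<times> int"
  define V0 where "V0 = {v\<in>lower_vertices S. L v = {}}"
  define V1 where "V1 = {v\<in>lower_vertices S. L v \<noteq> {}}"
  have V: "lower_vertices S = V0 \<union> V1" "V0 \<inter> V1 = {}" by (auto simp: V0_def V1_def)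
  have fV: "finite (lower_vertices S)" using S(1) by (auto simp: lower_vertices_def)
  \<comment> \<open>Both vertices lie over the same abscissa, so their two strict inequalities
    compare heights alone, in opposite directions.\<close>
  have "v = w" if vw: "v \<in> V0" "w \<in> V0" for v w
  proof (rule ccontr)
    assume "v \<noteq> w"
    have "v \<in> S" "w \<in> S" using vw by (auto simp: V0_def lower_vertices_def)
    then have "\<not> fst w < fst v" "\<not> fst v < fst w" using vw unfolding V0_def L_def by blast+
    then have "fst v = fst w" by simp
    moreover from \<open>v \<noteq> w\<close> \<open>v \<in> S\<close> \<open>w \<in> S\<close> vw
    obtain l l' :: real where "of_int (snd v) + l * real (fst v) < of_int (snd w) + l * real (fst w)"
       "of_int (snd w) + l' * real (fst w) < of_int (snd v) + l' * real (fst v)"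
      unfolding V0_def lower_vertices_def by blast
    ultimately show False by simp
  qed
  then have "card V0 \<le> 1" by (simp add: card_le_Suc0_iff_eq V0_def fV)
  moreover have "card V1 \<le> card (slopes S)"
  proof -
    \<comment> \<open>Increase the parameter from an \<open>l\<close> that isolates
      \<open>v\<close>: \<open>m v\<close> is the first value at which a point to the left ties with
      \<open>v\<close>, while points not to the left stay strictly heavier.\<close>
    define m where "m v = Min (cross v ` L v)" for v
    have key: "v \<in> face S (m v) \<and> m v \<in> slopes S \<and> (\<forall>q\<in>face S (m v). fst q \<le> fst v)" if v: "v \<in> V1" for v
    proof -
      have vS: "v \<in> S" and ne: "L v \<noteq> {}" using v by (auto simp: V1_def lower_vertices_def)
      obtain l :: real where l: "\<And>q. q \<in> S \<Longrightarrow> q \<noteq> v \<Longrightarrow>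
          of_int (snd v) + l * real (fst v) < of_int (snd q) + l * real (fst q)"
        using v by (auto simp: V1_def lower_vertices_def)
      have fL: "finite (L v)" using S(1) by (simp add: L_def)
      have "m v \<in> cross v ` L v" unfolding m_def using fL ne by simp
      then obtain p where p: "p \<in> L v" "m v = cross v p" by auto
      have pS: "p \<in> S" "fst p < fst v" using p by (auto simp: L_def)
      have dvd: "(int (fst q) - int (fst r)) dvd (snd r - snd q)" if "q \<in> S" "r \<in> S" "fst r \<noteq> fst q" for q r
        using S(2) that unfolding integral_slopes_def by blast
      have eq: "wt (m v) p = wt (m v) v"
        using cross_eq_iff[OF dvd[OF pS(1) vS], of "m v"] p pS by simp
      have "l < of_int (m v)"
      proof -
        have "of_int (snd v) + l * real (fst v) < of_int (snd p) + l * real (fst p)"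
          using l[of p] pS by blast
        moreover have "real_of_int (snd p + m v * int (fst p)) = of_int (snd v + m v * int (fst v))"
          using eq by (simp add: wt_def)
        ultimately have "(of_int (m v) - l) * (real (fst v) - real (fst p)) > 0" by (simp add: algebra_simps)
        then show ?thesis using pS by (simp add: zero_less_mult_iff)
      qed
      have left: "wt (m v) v \<le> wt (m v) q" if "q \<in> S" "fst q < fst v" for q
      proof -
        have "m v \<le> cross q v" unfolding m_def cross_commute[of q] using that fL by (intro Min_le) (auto simp: L_def)
        then show ?thesis using cross_le_iff[OF dvd[OF vS that(1)] that(2), of "m v"]
            cross_eq_iff[OF dvd[OF vS that(1)], of "m v"] that(2)
          by force
      qed
      have right: "wt (m v) v < wt (m v) q" if "q \<in> S" "fst v \<le> fst q" "q \<noteq> v" for q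
      proof -
        have "of_int (snd v) + l * real (fst v) < of_int (snd q) + l * real (fst q)"
          using l that by blast
        moreover have "(of_int (m v) - l) * (real (fst q) - real (fst v)) \<ge> 0"
          using \<open>l < of_int (m v)\<close> that by simp
        ultimately have "real_of_int (wt (m v) v) < of_int (wt (m v) q)" by (simp add: wt_def algebra_simps)
        then show ?thesis by simp
      qed
      have "wt (m v) v \<le> wt (m v) q" if "q \<in> S" for q
        using left[OF that] right[OF that] by (cases "q = v"; cases "fst q < fst v") auto
      then have vf: "v \<in> face S (m v)" using vS by (simp add: face_def)
      then have "p \<in> face S (m v)" using eq pS by (auto simp: face_def)
      then have "m v \<in> slopes S" using vf pS by (force simp: slopes_def)
      moreover have "fst q \<le> fst v" if "q \<in> face S (m v)" for q
      proof (rule ccontr)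
        assume "\<not> fst q \<le> fst v"
        then have "wt (m v) v < wt (m v) q" using right[of q] that face_subset[of S "m v"] by force
        then show False using face_wt_eq[OF vf that] by simp
      qed
      ultimately show ?thesis using vf by blast
    qed
    \<comment> \<open>\<open>v\<close> is recovered from \<open>m v\<close> as the point of the face
      with the largest abscissa.\<close>
    have "inj_on m V1"
    proof (rule inj_onI)
      fix v w assume "v \<in> V1" "w \<in> V1" "m v = m w"
      then have "v \<in> face S (m v)" "w \<in> face S (m v)" "fst v \<le> fst w" "fst w \<le> fst v"
        using key[of v] key[of w] by auto
      then show "v = w" using inj_onD[OF face_inj_on_fst] by (metis order_antisym)
    qed
    moreover have "m ` V1 \<subseteq> slopes S" using key by blast
    ultimately show ?thesis using finite_slopes[OF S] by (rule card_inj_on_le)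
  qed
  ultimately show ?thesis using V fV by (simp add: card_Un_disjoint)
qed

section \<open>Roots of perturbed polynomials\<close>

lemma zorder_poly_eq_order:
  fixes p :: "complex poly"
  assumes "p \<noteq> 0"
  shows "zorder (poly p) z = int (order z p)"
proof -
  obtain q where q: "p = [:-z, 1:] ^ order z p * q" "\<not> [:-z, 1:] dvd q"
    using order_decomp[OF assms] by blast
  show ?thesis
  proof (rule zorder_eqI[of UNIV])
    show "poly q z \<noteq> 0" using q(2) by (simp add: poly_eq_0_iff_dvd)
    show "poly p w = poly q w * (w - z) powi int (order z p)" if "w \<noteq> z" for w
      by (subst q(1)) (simp add: poly_power mult.commute)
  qed (auto intro!: holomorphic_intros)
qed

text \<open>Rouche's theorem for a circle. It weights zeros by winding numbers, which are 1 inside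
  and 0 outside; the strict inequality rules out zeros on the circle itself.\<close>

lemma sum_order_ball_eq:
  fixes p q :: "complex poly"
  assumes r: "r > 0" and less: "\<And>z. z \<in> sphere t r \<Longrightarrow> cmod (poly q z - poly p z) < cmod (poly p z)"
  shows "(\<Sum>z\<in>{z\<in>ball t r. poly q z = 0}. order z q) = (\<Sum>z\<in>{z\<in>ball t r. poly p z = 0}. order z p)"
    and "q \<noteq> 0"
proof -
  have "t + of_real r \<in> sphere t r" using r by (simp add: dist_norm)
  from less[OF this] show q0: "q \<noteq> 0" by auto
  from less[OF \<open>t + of_real r \<in> sphere t r\<close>] have p0: "p \<noteq> 0"
    by (metis norm_zero norm_not_less_zero poly_0)
  have eq: "(\<Sum>z\<in>{z. poly f z = 0}. winding_number (circlepath t r) z * of_int (zorder (poly f) z)) =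
      of_nat (\<Sum>z\<in>{z\<in>ball t r. poly f z = 0}. order z f)"
    if "f \<noteq> 0" and nz: "\<And>z. z \<in> sphere t r \<Longrightarrow> poly f z \<noteq> 0" for f
  proof -
    have "winding_number (circlepath t r) z = (if z \<in> ball t r then 1 else 0)" if "poly f z = 0" for z
    proof (cases "z \<in> ball t r")
      case True
      then show ?thesis using winding_number_circlepath[of z t r] by (simp add: dist_norm norm_minus_commute)
    next
      case False
      then have "z \<notin> cball t r" using nz[of z] that by force
      then show ?thesis using False winding_number_zero_outside[of "circlepath t r" "cball t r" z] r
        by simp
    qed
    then have "(\<Sum>z\<in>{z. poly f z = 0}. winding_number (circlepath t r) z * of_int (zorder (poly f) z)) =
      (\<Sum>z\<in>{z. poly f z = 0}. if z \<in> ball t r then of_nat (order z f) else 0)"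
      by (intro sum.cong refl) (auto simp: zorder_poly_eq_order[OF \<open>f \<noteq> 0\<close>])
    also have "\<dots> = (\<Sum>z\<in>{z. poly f z = 0} \<inter> ball t r. of_nat (order z f))"
      using poly_roots_finite[OF \<open>f \<noteq> 0\<close>] by (simp add: sum.inter_restrict)
    also have "{z. poly f z = 0} \<inter> ball t r = {z\<in>ball t r. poly f z = 0}" by auto
    finally show ?thesis by simp
  qed
  have "(\<Sum>z\<in>{z\<in>UNIV. poly p z + poly (q - p) z = 0}. winding_number (circlepath t r) z * of_int (zorder (\<lambda>z. poly p z + poly (q - p) z) z)) =
        (\<Sum>z\<in>{z\<in>UNIV. poly p z = 0}. winding_number (circlepath t r) z * of_int (zorder (poly p) z))"
    by (rule Rouche_theorem)
       (use r p0 q0 poly_roots_finite less in \<open>auto intro!: holomorphic_intros\<close>)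
  then have "(\<Sum>z\<in>{z. poly q z = 0}. winding_number (circlepath t r) z * of_int (zorder (poly q) z)) =
        (\<Sum>z\<in>{z. poly p z = 0}. winding_number (circlepath t r) z * of_int (zorder (poly p) z))"
    by simp
  moreover have "poly q z \<noteq> 0" "poly p z \<noteq> 0" if "z \<in> sphere t r" for z
    using less[OF that] by auto
  ultimately have "complex_of_nat (\<Sum>z\<in>{z\<in>ball t r. poly q z = 0}. order z q) = 
     of_nat (\<Sum>z\<in>{z\<in>ball t r. poly p z = 0}. order z p)"
    using eq[OF p0] eq[OF q0] by simp
  then show "(\<Sum>z\<in>{z\<in>ball t r. poly q z = 0}. order z q) = (\<Sum>z\<in>{z\<in>ball t r. poly p z = 0}. order z p)"
    using of_nat_eq_iff by blast
qed

text \<open>Continuity of roots, one-sided. The uniform degree bound is what turns coefficientwise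
  convergence into uniform convergence on a circle.\<close>

lemma eventually_order_le_sum_order_ball:
  fixes p :: "complex poly" and q :: "'a \<Rightarrow> complex poly"
  assumes p: "p \<noteq> 0" and eps: "\<epsilon> > 0" and deg: "\<And>x. degree (q x) \<le> N"
    and lim: "\<And>i. ((\<lambda>x. coeff (q x) i) \<longlongrightarrow> coeff p i) F"
  shows "eventually (\<lambda>x. q x \<noteq> 0 \<and> order t p \<le> (\<Sum>z\<in>{z\<in>ball t \<epsilon>. poly (q x) z = 0}. order z (q x))) F"
proof -
  have "finite {z. poly p z = 0}" using p by (rule poly_roots_finite)
  then obtain d where d: "d > 0" "\<And>z. z \<in> {z. poly p z = 0} \<Longrightarrow> z \<noteq> t \<Longrightarrow> d \<le> dist t z"
    using finite_set_avoid[of _ t] by blast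
  \<comment> \<open>Within this radius \<open>t\<close> is the only possible root of
    \<open>p\<close>, and the circle carries none.\<close>
  define r where "r = min \<epsilon> d / 2"
  have r: "r > 0" "r < \<epsilon>" "r < d" using eps d(1) by (auto simp: r_def)
  have nz: "poly p z \<noteq> 0" if "z \<in> sphere t r" for z
  proof
    assume "poly p z = 0"
    moreover have "z \<noteq> t" using that r by auto
    ultimately show False using d(2)[of z] that r by auto
  qed
  obtain \<mu> where \<mu>: "\<mu> > 0" "\<And>z. z \<in> sphere t r \<Longrightarrow> \<mu> \<le> cmod (poly p z)"
  proof -
    have "compact (sphere t r)" "sphere t r \<noteq> {}" using r by auto
    moreover have "continuous_on (sphere t r) (\<lambda>z. cmod (poly p z))" by (intro continuous_intros)
    ultimately obtain z0 where "z0 \<in> sphere t r" "\<And>z. z \<in> sphere t r \<Longrightarrow> cmod (poly p z0) \<le> cmod (poly p z)"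
      by (meson continuous_attains_inf)
    then show ?thesis using that[of "cmod (poly p z0)"] nz by auto
  qed
  define K where "K = max N (degree p)"
  define R where "R = cmod t + r"
  have "((\<lambda>x. \<Sum>i\<le>K. cmod (coeff (q x) i - coeff p i) * R ^ i) \<longlongrightarrow> (\<Sum>i\<le>K. cmod (coeff p i - coeff p i) * R ^ i)) F"
    by (intro tendsto_intros lim)
  then have "eventually (\<lambda>x. (\<Sum>i\<le>K. cmod (coeff (q x) i - coeff p i) * R ^ i) < \<mu>) F"
    using \<mu>(1) by (auto dest: order_tendstoD(2))
  then show ?thesis
  proof eventually_elim
    case (elim x)
    have less: "cmod (poly (q x) z - poly p z) < cmod (poly p z)" if z: "z \<in> sphere t r" for z
    proof -
      have "degree (q x - p) \<le> K" using deg[of x] by (intro degree_diff_le) (auto simp: K_def)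
      then have "poly (q x - p) z = (\<Sum>i\<le>K. coeff (q x - p) i * z ^ i)"
        unfolding poly_altdef by (intro sum.mono_neutral_left) (auto simp: coeff_eq_0 simp del: coeff_diff)
      then have "cmod (poly (q x) z - poly p z) \<le> (\<Sum>i\<le>K. cmod (coeff (q x - p) i * z ^ i))"
        by (metis norm_sum poly_diff)
      also have "\<dots> \<le> (\<Sum>i\<le>K. cmod (coeff (q x) i - coeff p i) * R ^ i)"
      proof (rule sum_mono)
        fix i
        have "cmod z \<le> R" using z norm_triangle_sub[of z t] by (simp add: R_def dist_norm norm_minus_commute)
        then show "cmod (coeff (q x - p) i * z ^ i) \<le> cmod (coeff (q x) i - coeff p i) * R ^ i"
          by (simp add: norm_mult norm_power mult_left_mono power_mono)
      qed
      finally show ?thesis using elim \<mu>(2)[OF z] by linarith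
    qed
    have fin: "finite {z\<in>ball t \<epsilon>. poly (q x) z = 0}" 
      using poly_roots_finite[OF sum_order_ball_eq(2)[OF r(1) less]] by simp
    have "order t p \<le> (\<Sum>z\<in>{z\<in>ball t r. poly p z = 0}. order z p)"
    proof (cases "poly p t = 0")
      case True
      show ?thesis
        by (rule member_le_sum[of t _ "\<lambda>z. order z p"]) (use True r poly_roots_finite[OF p] in auto)
    qed (simp add: order_root order_0I)
    also have "\<dots> = (\<Sum>z\<in>{z\<in>ball t r. poly (q x) z = 0}. order z (q x))"
      using sum_order_ball_eq(1)[OF r(1) less] by simp
    also have "\<dots> \<le> (\<Sum>z\<in>{z\<in>ball t \<epsilon>. poly (q x) z = 0}. order z (q x))"
      using r fin by (intro sum_mono2) auto
    finally show ?case using sum_order_ball_eq(2)[OF r(1) less] by simp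
  qed
qed

section \<open>Counting nonzero roots by extreme exponents, and rescaling the variable\<close>

lemma finite_nonzero_roots: "p \<noteq> 0 \<Longrightarrow> finite (nonzero_roots p)"
  using poly_roots_finite[of p] by (simp add: nonzero_roots_def)

lemma nz_root_count_eq:
  assumes "p \<noteq> 0"
  shows "nz_root_count p + order 0 p = degree p"
proof -
  have fin: "finite {z. poly p z = 0}" using assms by (rule poly_roots_finite)
  have "degree p = (\<Sum>z\<in>{z. poly p z = 0}. order z p)"
    using size_proots_complex[of p] assms by (simp add: size_multiset_overloaded_eq)
  also have "\<dots> = (\<Sum>z\<in>insert 0 (nonzero_roots p). order z p)"
    using fin finite_nonzero_roots[OF assms]
    by (intro sum.mono_neutral_left) (auto simp: nonzero_roots_def order_root)
  also have "\<dots> = order 0 p + nz_root_count p"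
    using finite_nonzero_roots[OF assms] by (simp add: nz_root_count_def nonzero_roots_def)
  finally show ?thesis by simp
qed

text \<open>Of the at most \<open>n\<close> roots, at least \<open>m\<close> sit at 0 because
  \<open>monom 1 m\<close> divides \<open>p\<close>.\<close>

lemma nz_root_count_le:
  assumes "p \<noteq> 0" "\<And>i. coeff p i \<noteq> 0 \<Longrightarrow> m \<le> i \<and> i \<le> n"
  shows "nz_root_count p \<le> n - m"
proof -
  have "monom 1 m dvd p" using assms(2) by (auto simp: monom_1_dvd_iff' not_le[symmetric])
  then have "m \<le> order 0 p" using assms(1) by (simp add: monom_1_dvd_iff)
  moreover have "degree p \<le> n" using assms by (meson leading_coeff_0_iff)
  ultimately show ?thesis using nz_root_count_eq[OF assms(1)] by linarith
qed

lemma nz_root_count_eqI: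
  assumes "coeff p m \<noteq> 0" "coeff p n \<noteq> 0" "\<And>i. coeff p i \<noteq> 0 \<Longrightarrow> m \<le> i \<and> i \<le> n"
  shows "nz_root_count p = n - m"
proof -
  have p: "p \<noteq> 0" using assms by auto
  have "order 0 p \<le> m"
  proof -
    have "monom 1 (order 0 p) dvd p" using p by (simp add: monom_1_dvd_iff)
    then show ?thesis using assms(1) by (meson monom_1_dvd_iff' not_le)
  qed
  moreover have "n \<le> degree p" using assms(2) by (rule le_degree)
  ultimately have "n - m \<le> nz_root_count p" using nz_root_count_eq[OF p] by linarith
  then show ?thesis using nz_root_count_le[OF p assms(3)] by force
qed

lemma order_pcompose_scale:
  fixes p :: "'a :: field poly"
  assumes "p \<noteq> 0" "c \<noteq> 0"
  shows "order z (pcompose p [:0, c:]) = order (c * z) p"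
proof -
  obtain q where q: "p = [:-(c * z), 1:] ^ order (c * z) p * q" "\<not> [:-(c * z), 1:] dvd q"
    using order_decomp[OF assms(1)] by blast
  have "pcompose [:-(c * z), 1:] [:0, c:] = smult c [:-z, 1:]" by (simp add: pcompose_pCons algebra_simps)
  moreover have "pcompose (r ^ n) [:0, c:] = pcompose r [:0, c:] ^ n" for r :: "'a poly" and n
    by (induction n) (simp_all add: pcompose_mult pcompose_1)
  ultimately have *: "pcompose p [:0, c:] = smult (c ^ order (c * z) p) ([:-z, 1:] ^ order (c * z) p * pcompose q [:0, c:])"
    by (subst q(1)) (simp only: pcompose_mult smult_power mult_smult_left)
  have "poly (pcompose q [:0, c:]) z \<noteq> 0" using q(2) by (simp add: poly_pcompose poly_eq_0_iff_dvd mult.commute)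
  then have "pcompose q [:0, c:] \<noteq> 0" "order z (pcompose q [:0, c:]) = 0" by (auto simp: order_0I)
  then show ?thesis using assms(2) unfolding *
    by (simp add: order_smult order_mult order_power_n_n)
qed

section \<open>Arguments relative to a rotated grid\<close>

lemma Arg2pi_cis_eq:
  assumes "r > 0"
  obtains l :: int where "Arg2pi (of_real r * cis a) = a + 2 * pi * of_int l"
proof -
  let ?z = "of_real r * cis a"
  have "?z = of_real r * cis (Arg2pi ?z)"
    using Arg2pi_eq[of ?z] assms by (simp add: norm_mult cis_conv_exp)
  then have "cis (Arg2pi ?z) = cis a" using assms by simp
  then have "sin (Arg2pi ?z) = sin a \<and> cos (Arg2pi ?z) = cos a" by (simp add: complex_eq_iff)
  then obtain l :: int where "Arg2pi ?z = a + 2 * pi * of_int l"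
    by (auto simp: sin_cos_eq_iff)
  then show ?thesis using that by blast
qed

lemma Arg2pi_cis_eqI:
  assumes "r > 0" "0 \<le> a" "a < 2 * pi"
  shows "Arg2pi (of_real r * cis a) = a"
  by (rule Arg2pi_unique[of r]) (use assms in \<open>auto simp: cis_conv_exp\<close>)

lemma polar_Arg2pi: "z = of_real (cmod z) * cis (Arg2pi z)"
  using Arg2pi_eq[of z] by (simp add: cis_conv_exp)

lemma arg02pi_eq_Arg2pi:
  assumes "z \<noteq> 0"
  shows "arg02pi z = Arg2pi z"
proof -
  have z: "z = of_real (cmod z) * cis (arg02pi z)"
    using Arg_eq[OF assms] by (auto simp: arg02pi_def cis_conv_exp exp_add algebra_simps)
  have "0 \<le> arg02pi z" "arg02pi z < 2 * pi"
    using Arg_bounded[of z] by (auto simp: arg02pi_def)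
  then show ?thesis using Arg2pi_cis_eqI[of "cmod z" "arg02pi z"] z assms by simp
qed

text \<open>The position of a nonzero complex number on the circle, cut at angle \<open>\<phi>\<close> and divided into \<open>M\<close>
  arcs of length 1.\<close>

definition grid_pos :: "nat \<Rightarrow> real \<Rightarrow> complex \<Rightarrow> real" where
  "grid_pos M \<phi> z = real M * Arg2pi (z * cis (- \<phi>)) / (2 * pi)"

lemma grid_pos_cases:
  assumes "z \<noteq> 0"
  obtains l :: int where "grid_pos M \<phi> z = real M * (Arg2pi z - \<phi>) / (2 * pi) + real M * of_int l"
proof -
  have "z * cis (- \<phi>) = of_real (cmod z) * cis (Arg2pi z - \<phi>)"
    by (subst polar_Arg2pi[of z]) (simp add: cis_mult mult.assoc)
  moreover obtain l :: int where "Arg2pi (of_real (cmod z) * cis (Arg2pi z - \<phi>)) = Arg2pi z - \<phi> + 2 * pi * of_int l"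
    using Arg2pi_cis_eq assms by (metis zero_less_norm_iff)
  ultimately have "grid_pos M \<phi> z = real M * (Arg2pi z - \<phi> + 2 * pi * of_int l) / (2 * pi)"
    by (simp add: grid_pos_def)
  then show ?thesis using that[of l] by (simp add: ring_distribs diff_divide_distrib add_divide_distrib)
qed

lemma grid_pos_rotate:
  assumes "z \<noteq> 0" "r > 0" "M > 0"
  obtains l :: int where
    "grid_pos M \<phi> (of_real r * cis (2 * pi * of_int k / real M) * z) = grid_pos M \<phi> z + of_int (k + int M * l)"
proof -
  let ?w = "of_real r * cis (2 * pi * of_int k / real M) * z"
  let ?u = "z * cis (- \<phi>)"
  have "?w * cis (- \<phi>) = of_real (r * cmod ?u) * cis (Arg2pi ?u + 2 * pi * of_int k / real M)"
  proof -
    have "?w * cis (- \<phi>) = of_real r * cis (2 * pi * of_int k / real M) * ?u" by simp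
    also have "?u = of_real (cmod ?u) * cis (Arg2pi ?u)" by (rule polar_Arg2pi)
    finally show ?thesis by (simp add: cis_mult[symmetric] mult_ac)
  qed
  moreover have "r * cmod ?u > 0" using assms by (simp add: norm_mult)
  ultimately obtain l :: int where "Arg2pi (?w * cis (- \<phi>)) = Arg2pi ?u + 2 * pi * of_int k / real M + 2 * pi * of_int l"
    using Arg2pi_cis_eq by metis
  then show ?thesis using that[of l] assms(3) by (simp add: grid_pos_def field_simps)
qed

lemma grid_pos_range: "M > 0 \<Longrightarrow> 0 \<le> grid_pos M \<phi> z" "M > 0 \<Longrightarrow> grid_pos M \<phi> z < real M"
  using Arg2pi_ge_0 Arg2pi_lt_2pi by (auto simp: grid_pos_def field_simps)

text \<open>A turn by a multiple of \<open>2 * pi / M\<close> maps the grid to itself, so arcs are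
  permuted cyclically and boundaries go to boundaries. The range of \<open>grid_pos\<close> selects
  the residue.\<close>

lemma floor_grid_pos_rotate:
  assumes "z \<noteq> 0" "r > 0" "M > 0"
  shows "\<lfloor>grid_pos M \<phi> (of_real r * cis (2 * pi * of_int k / real M) * z)\<rfloor> = (\<lfloor>grid_pos M \<phi> z\<rfloor> + k) mod int M"
    and "grid_pos M \<phi> (of_real r * cis (2 * pi * of_int k / real M) * z) \<in> \<int> \<longleftrightarrow> grid_pos M \<phi> z \<in> \<int>"
proof -
  let ?w = "of_real r * cis (2 * pi * of_int k / real M) * z"
  obtain l where l: "grid_pos M \<phi> ?w = grid_pos M \<phi> z + of_int (k + int M * l)"
    using grid_pos_rotate[OF assms] by blast
  have "\<lfloor>grid_pos M \<phi> ?w\<rfloor> = \<lfloor>grid_pos M \<phi> z\<rfloor> + k + int M * l"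
    unfolding l by linarith
  then have "\<lfloor>grid_pos M \<phi> ?w\<rfloor> mod int M = (\<lfloor>grid_pos M \<phi> z\<rfloor> + k) mod int M" by simp
  moreover have "0 \<le> \<lfloor>grid_pos M \<phi> ?w\<rfloor>" "\<lfloor>grid_pos M \<phi> ?w\<rfloor> < int M"
    using grid_pos_range[OF assms(3), of \<phi> ?w] by (auto simp: floor_less_iff)
  ultimately show "\<lfloor>grid_pos M \<phi> ?w\<rfloor> = (\<lfloor>grid_pos M \<phi> z\<rfloor> + k) mod int M" by simp
  show "grid_pos M \<phi> ?w \<in> \<int> \<longleftrightarrow> grid_pos M \<phi> z \<in> \<int>"
    unfolding l by (metis Ints_add Ints_diff Ints_of_int add_diff_cancel_right')
qed

text \<open>\<open>Arg2pi\<close> is continuous off its cut, and on the cut the position would be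
  the integer 0.\<close>

lemma grid_pos_locally_constant:
  assumes "t \<noteq> 0" "grid_pos M \<phi> t \<notin> \<int>"
  shows "eventually (\<lambda>z. grid_pos M \<phi> z \<notin> \<int> \<and> \<lfloor>grid_pos M \<phi> z\<rfloor> = \<lfloor>grid_pos M \<phi> t\<rfloor>) (nhds t)"
proof -
  have "t * cis (- \<phi>) \<notin> \<real>\<^sub>\<ge>\<^sub>0"
  proof
    assume "t * cis (- \<phi>) \<in> \<real>\<^sub>\<ge>\<^sub>0"
    then have "Arg2pi (t * cis (- \<phi>)) = 0" by (auto simp: Arg2pi_eq_0 complex_nonneg_Reals_iff complex_is_Real_iff)
    then show False using assms(2) by (simp add: grid_pos_def)
  qed
  then have "isCont Arg2pi (t * cis (- \<phi>))" by (rule continuous_at_Arg2pi)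
  then have "isCont (\<lambda>z. Arg2pi (z * cis (- \<phi>))) t"
    by (rule isCont_o2[rotated]) simp
  then have "isCont (grid_pos M \<phi>) t" unfolding grid_pos_def[abs_def] by simp
  then have lim: "(grid_pos M \<phi> \<longlongrightarrow> grid_pos M \<phi> t) (nhds t)" by (simp add: isCont_def tendsto_nhds_iff)
  have "of_int \<lfloor>grid_pos M \<phi> t\<rfloor> < grid_pos M \<phi> t"
    using assms(2) by (metis Ints_of_int of_int_floor_le order_le_less)
  moreover have "grid_pos M \<phi> t < of_int \<lfloor>grid_pos M \<phi> t\<rfloor> + 1" by linarith
  ultimately have "eventually (\<lambda>z. of_int \<lfloor>grid_pos M \<phi> t\<rfloor> < grid_pos M \<phi> z) (nhds t)"
     "eventually (\<lambda>z. grid_pos M \<phi> z < of_int \<lfloor>grid_pos M \<phi> t\<rfloor> + 1) (nhds t)"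
    using order_tendstoD[OF lim] by auto
  then show ?thesis
  proof eventually_elim
    case (elim z)
    then have fl: "\<lfloor>grid_pos M \<phi> z\<rfloor> = \<lfloor>grid_pos M \<phi> t\<rfloor>" by (simp add: floor_eq_iff)
    then show ?case using elim(1) by (auto elim!: Ints_cases)
  qed
qed

lemma arg_interval_iff_grid_pos:
  assumes "z \<noteq> 0" "grid_pos M \<phi> z \<notin> \<int>" and \<phi>: "0 < \<phi>" "\<phi> < 2 * pi / real M" and "j < M"
  shows "\<phi> \<le> arg02pi z \<and> arg02pi z \<le> \<phi> + 2 * pi * real j / real M \<longleftrightarrow> \<lfloor>grid_pos M \<phi> z\<rfloor> < int j"
proof -
  have M: "real M > 0" using assms by simp
  define A where "A = Arg2pi z"
  have A: "0 \<le> A" "A < 2 * pi" "arg02pi z = A"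
    using Arg2pi_ge_0 Arg2pi_lt_2pi arg02pi_eq_Arg2pi[OF assms(1)] by (auto simp: A_def)
  have w: "z * cis (- \<phi>) = of_real (cmod z) * cis (A - \<phi>)"
    unfolding A_def by (subst polar_Arg2pi[of z]) (simp add: cis_mult mult.assoc)
  show ?thesis
  proof (cases "\<phi> \<le> A")
    case True
    have "Arg2pi (z * cis (- \<phi>)) = A - \<phi>"
      unfolding w using assms A True by (intro Arg2pi_cis_eqI) auto
    then have gp: "grid_pos M \<phi> z = real M * (A - \<phi>) / (2 * pi)" by (simp add: grid_pos_def)
    \<comment> \<open>The closed endpoint is harmless: a non-integral position never equals
      \<open>real j\<close>.\<close>
    have "A \<le> \<phi> + 2 * pi * real j / real M \<longleftrightarrow> grid_pos M \<phi> z \<le> real j"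
      unfolding gp using M by (simp add: field_simps)
    also have "\<dots> \<longleftrightarrow> grid_pos M \<phi> z < real j"
      using assms(2) by (metis Ints_of_nat order_le_less)
    also have "\<dots> \<longleftrightarrow> \<lfloor>grid_pos M \<phi> z\<rfloor> < int j" by (simp add: floor_less_iff)
    finally show ?thesis using True A by simp
  next
    \<comment> \<open>Arguments below \<phi> wrap around into the last arc, as \<phi> is less than
      one arc; \<open>j < M\<close> leaves this arc uncounted.\<close>
    case False
    have "\<phi> < 2 * pi"
    proof -
      have "2 * pi / real M \<le> 2 * pi / 1" using assms by (intro divide_left_mono) auto
      then show ?thesis using \<phi> by linarith
    qed
    have "cis (A - \<phi>) = cis (A - \<phi> + 2 * pi)" by (simp add: cis_mult[symmetric] flip: cis_mult)
    then have "Arg2pi (z * cis (- \<phi>)) = A - \<phi> + 2 * pi"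
      unfolding w using assms A False \<open>\<phi> < 2 * pi\<close> by (simp only:) (intro Arg2pi_cis_eqI, auto)
    then have "grid_pos M \<phi> z = real M + real M * (A - \<phi>) / (2 * pi)" 
      by (simp add: grid_pos_def ring_distribs diff_divide_distrib add_divide_distrib)
    moreover have "real M * (A - \<phi>) / (2 * pi) \<ge> -1"
    proof -
      have "\<phi> * real M < 2 * pi" using \<phi>(2) M by (simp add: field_simps)
      moreover have "0 \<le> real M * A" using A M by simp
      ultimately show ?thesis by (simp add: field_simps)
    qed
    ultimately have "grid_pos M \<phi> z \<ge> real j" using assms(5) by linarith
    then show ?thesis using False A by (simp add: floor_less_iff)
  qed
qed

text \<open>Each point excludes only the translates of its argument by multiples of
  \<open>2 * pi / M\<close>, so the bad angles are countable.\<close>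

lemma exists_generic_angle:
  assumes "finite T" "\<And>t. t \<in> T \<Longrightarrow> t \<noteq> 0" "M > 0"
  shows "\<exists>\<phi>. 0 < \<phi> \<and> \<phi> < 2 * pi / real M \<and> (\<forall>t\<in>T. grid_pos M \<phi> t \<notin> \<int>)"
proof -
  define X where "X = (\<lambda>(t, m). Arg2pi t + 2 * pi / real M * of_int m) ` (T \<times> (UNIV :: int set))"
  have "countable X" unfolding X_def using assms(1) by (intro countable_image countable_SIGMA) (auto intro: countable_finite)
  moreover have "uncountable {0<..<2 * pi / real M}" using assms(3) by (simp add: uncountable_open_interval)
  ultimately have "\<not> {0<..<2 * pi / real M} \<subseteq> X" using countable_subset by blast
  then obtain \<phi> where \<phi>: "0 < \<phi>" "\<phi> < 2 * pi / real M" "\<phi> \<notin> X"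
    by (metis greaterThanLessThan_iff subsetI)
  have "grid_pos M \<phi> t \<notin> \<int>" if t: "t \<in> T" for t
  proof
    assume "grid_pos M \<phi> t \<in> \<int>"
    then obtain k :: int where k: "grid_pos M \<phi> t = of_int k" by (auto elim: Ints_cases)
    obtain l :: int where "grid_pos M \<phi> t = real M * (Arg2pi t - \<phi>) / (2 * pi) + real M * of_int l"
      using grid_pos_cases assms(2)[OF t] by blast
    then have "\<phi> = Arg2pi t + 2 * pi / real M * of_int (int M * l - k)"
      using k assms(3) by (simp add: field_simps)
    then have "\<phi> \<in> X" unfolding X_def using t by (intro image_eqI[where x = "(t, int M * l - k)"]) simp_all
    then show False using \<phi>(3) by simp
  qed
  then show ?thesis using \<phi> by blast
qed

section \<open>Root clusters of the edges\<close>

text \<open>Powers are integral because reflection makes heights negative.\<close>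

definition spec_laurent :: "(nat \<times> int) set \<Rightarrow> (nat \<times> int \<Rightarrow> complex) \<Rightarrow> complex \<Rightarrow> complex poly" where
  "spec_laurent S F b = (\<Sum>p\<in>S. monom (F p * b powi snd p) (fst p))"

definition edge_poly :: "(nat \<times> int) set \<Rightarrow> (nat \<times> int \<Rightarrow> complex) \<Rightarrow> int \<Rightarrow> complex poly" where
  "edge_poly S F e = (\<Sum>p\<in>face S e. monom (F p) (fst p))"

text \<open>The result of substituting \<open>x = b powi e * u\<close> and dividing by the lowest
  power of \<open>b\<close>, so that a limit for \<open>b\<close> tending to 0 exists.\<close>

definition rescaled :: "(nat \<times> int) set \<Rightarrow> (nat \<times> int \<Rightarrow> complex) \<Rightarrow> int \<Rightarrow> complex \<Rightarrow> complex poly" where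
  "rescaled S F e b = (\<Sum>p\<in>S. monom (F p * b powi (wt e p - Min (wt e ` S))) (fst p))"

lemma coeff_edge_poly_face:
  assumes "finite S" "p \<in> face S e"
  shows "coeff (edge_poly S F e) (fst p) = F p"
proof -
  have "coeff (edge_poly S F e) (fst p) = (\<Sum>q\<in>face S e. if fst q = fst p then F q else 0)"
    by (simp add: edge_poly_def coeff_sum)
  also have "\<dots> = (\<Sum>q\<in>face S e. if q = p then F q else 0)"
    using assms(2) face_inj_on_fst[of S e] by (intro sum.cong refl) (auto dest: inj_onD)
  also have "\<dots> = F p" using assms finite_subset[OF face_subset] by (simp add: sum.delta)
  finally show ?thesis .
qed

lemma coeff_edge_poly_nonzero:
  assumes "coeff (edge_poly S F e) i \<noteq> 0"
  obtains p where "p \<in> face S e" "fst p = i"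
proof -
  have "(\<Sum>p\<in>face S e. if fst p = i then F p else 0) \<noteq> 0"
    using assms by (simp add: edge_poly_def coeff_sum)
  then obtain p where "p \<in> face S e" "(if fst p = i then F p else 0) \<noteq> 0" by (rule sum.not_neutral_contains_not_neutral)
  then show ?thesis using that[of p] by (auto split: if_splits)
qed

text \<open>A face has at most one point over each abscissa, so no coefficients cancel and the
  extreme exponents are \<open>lo S e\<close> and \<open>hi S e\<close>.\<close>

lemma nz_root_count_edge_poly:
  assumes "finite S" "S \<noteq> {}" "\<And>p. p \<in> S \<Longrightarrow> F p \<noteq> 0"
  shows "nz_root_count (edge_poly S F e) = hi S e - lo S e" "edge_poly S F e \<noteq> 0"
proof -
  obtain p q where pq: "p \<in> face S e" "fst p = lo S e" "q \<in> face S e" "fst q = hi S e"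
    using lo_hi_attained[OF assms(1,2)] by blast
  then have "F p \<noteq> 0" "F q \<noteq> 0" using face_subset assms(3) by blast+
  then have nz: "coeff (edge_poly S F e) (lo S e) \<noteq> 0" "coeff (edge_poly S F e) (hi S e) \<noteq> 0"
    using coeff_edge_poly_face[OF assms(1) pq(1), of F] coeff_edge_poly_face[OF assms(1) pq(3), of F] pq by simp_all
  then show "edge_poly S F e \<noteq> 0" by auto
  show "nz_root_count (edge_poly S F e) = hi S e - lo S e"
  proof (rule nz_root_count_eqI[OF nz])
    fix i assume "coeff (edge_poly S F e) i \<noteq> 0"
    then obtain r where "r \<in> face S e" "fst r = i" by (rule coeff_edge_poly_nonzero)
    then show "lo S e \<le> i \<and> i \<le> hi S e" using lo_hi_bounds[OF assms(1)] by blast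
  qed
qed

lemma nz_root_count_spec_laurent_le:
  assumes "finite S" "spec_laurent S F b \<noteq> 0"
  shows "nz_root_count (spec_laurent S F b) \<le> Max (fst ` S) - Min (fst ` S)"
proof (rule nz_root_count_le[OF assms(2)])
  fix i assume "coeff (spec_laurent S F b) i \<noteq> 0"
  then have "(\<Sum>p\<in>S. if fst p = i then F p * b powi snd p else 0) \<noteq> 0"
    by (simp add: spec_laurent_def coeff_sum)
  then obtain p where "p \<in> S" "(if fst p = i then F p * b powi snd p else 0) \<noteq> 0"
    by (rule sum.not_neutral_contains_not_neutral)
  then have "i \<in> fst ` S" by (auto split: if_splits)
  then show "Min (fst ` S) \<le> i \<and> i \<le> Max (fst ` S)" using assms(1) by auto
qed

lemma pcompose_spec_laurent:
  assumes "b \<noteq> 0"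
  shows "pcompose (spec_laurent S F b) [:0, b powi e:] = smult (b powi Min (wt e ` S)) (rescaled S F e b)"
proof (rule poly_eqI)
  fix i
  have "(b powi e) ^ i * (if fst p = i then F p * b powi snd p else 0) =
      b powi Min (wt e ` S) * (if fst p = i then F p * b powi (wt e p - Min (wt e ` S)) else 0)" for p
  proof -
    have "(b powi e) ^ fst p * b powi snd p = b powi wt e p"
      using assms by (simp add: wt_def power_int_add power_int_mult)
    also have "\<dots> = b powi Min (wt e ` S) * b powi (wt e p - Min (wt e ` S))"
      using assms by (simp flip: power_int_add)
    finally show ?thesis by (auto simp: mult_ac)
  qed
  then show "coeff (pcompose (spec_laurent S F b) [:0, b powi e:]) i = 
      coeff (smult (b powi Min (wt e ` S)) (rescaled S F e b)) i"
    by (simp add: spec_laurent_def rescaled_def coeff_sum coeff_pcompose_linear sum_distrib_left)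
qed

text \<open>Off the face the remaining exponent of \<open>b\<close> is positive; on the face it is
  0.\<close>

lemma tendsto_coeff_rescaled:
  assumes "finite S" "S \<noteq> {}"
  shows "((\<lambda>b. coeff (rescaled S F e b) i) \<longlongrightarrow> coeff (edge_poly S F e) i) (at 0)"
proof -
  define m where "m = Min (wt e ` S)"
  have lim: "((\<lambda>b::complex. b powi (wt e p - m)) \<longlongrightarrow> (if p \<in> face S e then 1 else 0)) (at 0)" if p: "p \<in> S" for p
  proof -
    have "m \<le> wt e p" unfolding m_def using assms p by simp
    moreover have "p \<in> face S e \<longleftrightarrow> wt e p = m"
      unfolding face_def m_def using assms p by (auto intro: antisym Min_eqI[symmetric])
    moreover have "((\<lambda>b::complex. b ^ n) \<longlongrightarrow> 0) (at 0)" if "n > 0" for n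
      by (rule tendsto_eq_intros | use that in simp)+
    moreover define n where "n = nat (wt e p - m)"
    ultimately show ?thesis by (cases "wt e p = m") (auto simp: power_int_def)
  qed
  have "((\<lambda>b. \<Sum>p\<in>S. if fst p = i then F p * b powi (wt e p - m) else 0) \<longlongrightarrow>
      (\<Sum>p\<in>S. if fst p = i then F p * (if p \<in> face S e then 1 else 0) else 0)) (at 0)"
  proof (rule tendsto_sum)
    fix p assume "p \<in> S"
    from tendsto_mult[OF tendsto_const lim[OF this]]
    show "((\<lambda>b. if fst p = i then F p * b powi (wt e p - m) else 0) \<longlongrightarrow>
        (if fst p = i then F p * (if p \<in> face S e then 1 else 0) else 0)) (at 0)"
      by (cases "fst p = i") (simp_all only: if_True if_False simp_thms tendsto_const)
  qed
  also have "(\<Sum>p\<in>S. if fst p = i then F p * (if p \<in> face S e then 1 else 0) else 0) = 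
     (\<Sum>p\<in>S. if p \<in> face S e then if fst p = i then F p else 0 else 0)" by (intro sum.cong) auto
  also have "\<dots> = (\<Sum>p\<in>face S e. if fst p = i then F p else 0)"
    using assms face_subset[of S e] by (simp add: sum.inter_restrict[symmetric] Int_absorb1)
  finally show ?thesis unfolding m_def rescaled_def edge_poly_def coeff_sum coeff_monom .
qed

lemma degree_rescaled_le:
  assumes "finite S"
  shows "degree (rescaled S F e b) \<le> Max (fst ` S)"
  unfolding rescaled_def
proof (rule degree_sum_le)
  fix p assume "p \<in> S"
  then have "fst p \<le> Max (fst ` S)" using assms by simp
  then show "degree (monom (F p * b powi (wt e p - Min (wt e ` S))) (fst p)) \<le> Max (fst ` S)"
    using degree_monom_le order_trans by blast
qed (use assms in auto)

text \<open>Continuity of roots is applied to \<open>rescaled\<close>, whose roots become those of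
  \<open>spec_laurent\<close> on multiplication by \<open>b powi e\<close>.\<close>

lemma eventually_root_cluster:
  assumes S: "finite S" "S \<noteq> {}" "\<And>p. p \<in> S \<Longrightarrow> F p \<noteq> 0" and "\<epsilon> > 0"
  shows "eventually (\<lambda>b. spec_laurent S F b \<noteq> 0 \<and> order t (edge_poly S F e) \<le>
    (\<Sum>x\<in>{x\<in>(*) (b powi e) ` ball t \<epsilon>. poly (spec_laurent S F b) x = 0}. order x (spec_laurent S F b))) (at 0)"
proof -
  have "eventually (\<lambda>b. rescaled S F e b \<noteq> 0 \<and> order t (edge_poly S F e) \<le>
     (\<Sum>z\<in>{z\<in>ball t \<epsilon>. poly (rescaled S F e b) z = 0}. order z (rescaled S F e b))) (at 0)"
    using nz_root_count_edge_poly(2)[of S F, OF S] assms(4) degree_rescaled_le[OF S(1)] tendsto_coeff_rescaled[OF S(1,2)]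
    by (rule eventually_order_le_sum_order_ball)
  moreover have "eventually (\<lambda>b. b \<noteq> (0::complex)) (at 0)" by (simp add: eventually_at_filter)
  ultimately show ?thesis
  proof eventually_elim
    case (elim b)
    let ?G = "spec_laurent S F b" and ?H = "rescaled S F e b" and ?c = "b powi e"
    have c: "?c \<noteq> 0" using elim by simp
    have GH: "pcompose ?G [:0, ?c:] = smult (b powi Min (wt e ` S)) ?H"
      using elim by (intro pcompose_spec_laurent) auto
    then have G0: "?G \<noteq> 0" using elim by auto
    have ord: "order z ?H = order (?c * z) ?G" for z
      using order_pcompose_scale[OF G0 c, of z] elim unfolding GH by (simp add: order_smult)
    have root: "poly ?H z = 0 \<longleftrightarrow> poly ?G (?c * z) = 0" for z
      using G0 elim by (simp add: order_root ord)
    have "(\<Sum>z\<in>{z\<in>ball t \<epsilon>. poly ?H z = 0}. order z ?H) = (\<Sum>x\<in>(*) ?c ` {z\<in>ball t \<epsilon>. poly ?H z = 0}. order x ?G)"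
      using c by (subst sum.reindex) (auto simp: inj_on_def ord)
    also have "(*) ?c ` {z\<in>ball t \<epsilon>. poly ?H z = 0} = {x\<in>(*) ?c ` ball t \<epsilon>. poly ?G x = 0}"
      by (auto simp: root)
    finally show ?case using elim G0 by simp
  qed
qed

text \<open>After division by \<open>b powi e'\<close> the first disc shrinks to 0, while the second
  stays away from 0.\<close>

lemma eventually_clusters_disjoint:
  fixes t t' :: complex
  assumes "e' < e" "\<epsilon> < cmod t'"
  shows "eventually (\<lambda>b. (*) (b powi e) ` ball t \<epsilon>' \<inter> (*) (b powi e') ` ball t' \<epsilon> = {}) (at 0)"
proof -
  define n where "n = nat (e - e')"
  have n: "n > 0" "e = int n + e'" using assms by (auto simp: n_def)
  have "((\<lambda>b::complex. cmod b ^ n * (cmod t + \<epsilon>')) \<longlongrightarrow> 0) (at 0)"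
    by (rule tendsto_eq_intros refl | use n in simp)+
  moreover have "0 < cmod t' - \<epsilon>" using assms by simp
  ultimately have "eventually (\<lambda>b::complex. cmod b ^ n * (cmod t + \<epsilon>') < cmod t' - \<epsilon>) (at 0)"
    by (rule order_tendstoD(2))
  moreover have "eventually (\<lambda>b. b \<noteq> (0::complex)) (at 0)" by (simp add: eventually_at_filter)
  ultimately show ?thesis
  proof eventually_elim
    case (elim b)
    have False if z: "z \<in> ball t \<epsilon>'" "z' \<in> ball t' \<epsilon>" and eq: "b powi e * z = b powi e' * z'" for z z'
    proof -
      have "b powi e = b powi e' * b ^ n" using elim n by (simp add: power_int_add)
      then have "b ^ n * z = z'" using eq elim by simp
      then have "cmod z' = cmod b ^ n * cmod z" by (auto simp: norm_mult norm_power)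
      also have "\<dots> \<le> cmod b ^ n * (cmod t + \<epsilon>')"
        using z(1) norm_triangle_sub[of z t] by (intro mult_left_mono) (auto simp: dist_norm norm_minus_commute)
      also have "\<dots> < cmod t' - \<epsilon>" using elim by simp
      also have "\<dots> < cmod z'" using z(2) norm_triangle_sub[of t' z'] by (auto simp: dist_norm)
      finally show False .
    qed
    then show ?case by blast
  qed
qed

text \<open>The lower bounds for \<open>P\<close> and for its negation add up to the total, so both are sharp.\<close>

lemma sum_clusters_eq:
  fixes w :: "'a \<Rightarrow> nat" and v :: "'i \<Rightarrow> nat"
  assumes fin: "finite R" "finite I" and disj: "disjoint_family_on A I"
    and lower: "\<And>i. i \<in> I \<Longrightarrow> v i \<le> (\<Sum>z\<in>R \<inter> A i. w z)"
    and total: "(\<Sum>z\<in>R. w z) \<le> (\<Sum>i\<in>I. v i)"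
    and P: "\<And>i z. i \<in> I \<Longrightarrow> z \<in> A i \<Longrightarrow> P z \<longleftrightarrow> Q i"
  shows "(\<Sum>z\<in>{z\<in>R. P z}. w z) = (\<Sum>i\<in>{i\<in>I. Q i}. v i)"
proof -
  have ge: "(\<Sum>i\<in>{i\<in>I. Q' i}. v i) \<le> (\<Sum>z\<in>{z\<in>R. P' z}. w z)"
    if P': "\<And>i z. i \<in> I \<Longrightarrow> z \<in> A i \<Longrightarrow> P' z \<longleftrightarrow> Q' i" for P' Q'
  proof -
    have "(\<Sum>i\<in>{i\<in>I. Q' i}. v i) \<le> (\<Sum>i\<in>{i\<in>I. Q' i}. \<Sum>z\<in>R \<inter> A i. w z)"
      using lower by (intro sum_mono) auto
    also have "\<dots> = (\<Sum>z\<in>(\<Union>i\<in>{i\<in>I. Q' i}. R \<inter> A i). w z)"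
      using fin disj by (intro sum.UNION_disjoint[symmetric]) (auto simp: disjoint_family_on_def)
    also have "\<dots> \<le> (\<Sum>z\<in>{z\<in>R. P' z}. w z)" using fin P' by (intro sum_mono2) auto
    finally show ?thesis .
  qed
  have "(\<Sum>z\<in>R. w z) = (\<Sum>z\<in>{z\<in>R. P z}. w z) + (\<Sum>z\<in>{z\<in>R. \<not> P z}. w z)"
    using sum.inter_filter[OF fin(1)] fin(1)
    by (subst sum.union_disjoint[symmetric]) (auto intro!: sum.cong)
  moreover have "(\<Sum>i\<in>I. v i) = (\<Sum>i\<in>{i\<in>I. Q i}. v i) + (\<Sum>i\<in>{i\<in>I. \<not> Q i}. v i)"
    using fin(2) by (subst sum.union_disjoint[symmetric]) (auto intro!: sum.cong)
  ultimately show ?thesis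
    using total ge[of P Q] ge[of "\<lambda>z. \<not> P z" "\<lambda>i. \<not> Q i"] P by fastforce
qed

text \<open>A real supremum dominates its members only when they are bounded: here both counts lie
  between 0 and \<open>nz_root_count p\<close>.\<close>

lemma bias_ge:
  assumes "p \<noteq> 0" "0 \<le> \<alpha>" "\<alpha> \<le> \<beta>" "\<beta> \<le> 2 * pi"
  shows "\<bar>real (N_arg \<alpha> \<beta> p) - real (nz_root_count p) * (\<beta> - \<alpha>) / (2 * pi)\<bar> \<le> bias p"
proof -
  let ?D = "\<lambda>ab. \<bar>real (N_arg (fst ab) (snd ab) p) - real (nz_root_count p) * (snd ab - fst ab) / (2 * pi)\<bar>"
  let ?J = "{(\<alpha>, \<beta>). 0 \<le> \<alpha> \<and> \<alpha> \<le> \<beta> \<and> \<beta> \<le> 2 * pi}"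
  have "bdd_above (?D ` ?J)"
  proof (rule bdd_aboveI2)
    fix ab assume ab: "ab \<in> ?J"
    have "N_arg (fst ab) (snd ab) p \<le> nz_root_count p"
      unfolding N_arg_def nz_root_count_def using finite_nonzero_roots[OF assms(1)] by (intro sum_mono2) auto
    moreover have "0 \<le> (snd ab - fst ab) / (2 * pi)" "(snd ab - fst ab) / (2 * pi) \<le> 1" using ab by (auto simp: field_simps)
    then have "0 \<le> real (nz_root_count p) * ((snd ab - fst ab) / (2 * pi))"
      "real (nz_root_count p) * ((snd ab - fst ab) / (2 * pi)) \<le> real (nz_root_count p) * 1"
      by (intro mult_nonneg_nonneg mult_left_mono; simp)+
    ultimately show "?D ab \<le> real (nz_root_count p)" by simp
  qed
  then have "?D (\<alpha>, \<beta>) \<le> bias p" unfolding bias_def by (intro cSUP_upper) (use assms in auto)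
  then show ?thesis by simp
qed

theorem exists_large_bias:
  fixes F :: "nat \<times> int \<Rightarrow> complex"
  assumes S: "finite S" "S \<noteq> {}" "\<And>p. p \<in> S \<Longrightarrow> F p \<noteq> 0" and int: "integral_slopes S"
  shows "\<exists>b. b \<noteq> 0 \<and> spec_laurent S F b \<noteq> 0 \<and> sqrt (real (card (slopes S))) / 6 \<le> bias (spec_laurent S F b)"
proof -
  define E where "E = slopes S"
  define P where "P e = edge_poly S F e" for e
  define T where "T e = nonzero_roots (P e)" for e
  have finE: "finite E" unfolding E_def using finite_slopes[OF S(1) int] .
  have P0: "P e \<noteq> 0" and nP: "nz_root_count (P e) = hi S e - lo S e" for e
    unfolding P_def using nz_root_count_edge_poly[of S F, OF S] by blast+
  have finT: "finite (T e)" for e unfolding T_def using finite_nonzero_roots[OF P0] .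
  have T0: "t \<noteq> 0" if "t \<in> T e" for t e using that by (simp add: T_def nonzero_roots_def)
  define I where "I = Sigma E T"
  have finI: "finite I" unfolding I_def using finE finT by blast

  \<comment> \<open>This size makes the slopes distinct modulo \<open>M\<close> and every edge width
    less than \<open>M\<close>, hence coprime to it.\<close>
  obtain M where M: "prime M" "(\<Sum>e\<in>E. 2 * nat \<bar>e\<bar>) + Max (fst ` S) + 3 < M" using bigger_prime by blast
  have M0: "M > 0" "M \<ge> 3" using M by auto
  have eM: "2 * \<bar>e\<bar> < int M" if "e \<in> E" for e
  proof -
    have "2 * nat \<bar>e\<bar> \<le> (\<Sum>e\<in>E. 2 * nat \<bar>e\<bar>)" using that finE by (intro member_le_sum) auto
    then show ?thesis using M(2) by linarith
  qed
  have hiM: "hi S e - lo S e < M" for e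
  proof -
    obtain q where "q \<in> face S e" "fst q = hi S e" using lo_hi_attained[OF S(1,2)] by blast
    then have "hi S e \<in> fst ` S" using face_subset by force
    then have "hi S e \<le> Max (fst ` S)" using S(1) by simp
    then show ?thesis using M(2) by linarith
  qed

  obtain \<phi> where \<phi>: "0 < \<phi>" "\<phi> < 2 * pi / real M" and generic: "\<And>t. t \<in> (\<Union>e\<in>E. T e) \<Longrightarrow> grid_pos M \<phi> t \<notin> \<int>"
    using exists_generic_angle[of "\<Union>e\<in>E. T e" M] finE finT T0 M0 by blast
  define s where "s t = \<lfloor>grid_pos M \<phi> t\<rfloor>" for t

  \<comment> \<open>The disc around \<open>t\<close> has to avoid 0, to be disjoint from the other
    discs of the same edge, and to stay inside one open arc.\<close>
  have "\<exists>\<epsilon>>0. \<epsilon> < cmod t \<and> (\<forall>t'\<in>T e. t' \<noteq> t \<longrightarrow> 2 * \<epsilon> \<le> dist t t') \<and>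
      (\<forall>z\<in>ball t \<epsilon>. grid_pos M \<phi> z \<notin> \<int> \<and> \<lfloor>grid_pos M \<phi> z\<rfloor> = s t)" if "(e, t) \<in> I" for e t
  proof -
    have t: "t \<noteq> 0" "grid_pos M \<phi> t \<notin> \<int>" using that T0 generic by (auto simp: I_def)
    obtain d1 where d1: "d1 > 0" "\<And>z. dist z t < d1 \<Longrightarrow> grid_pos M \<phi> z \<notin> \<int> \<and> \<lfloor>grid_pos M \<phi> z\<rfloor> = s t"
      using grid_pos_locally_constant[OF t] unfolding eventually_nhds_metric s_def by blast
    obtain d2 where d2: "d2 > 0" "\<And>t'. t' \<in> T e \<Longrightarrow> t' \<noteq> t \<Longrightarrow> d2 \<le> dist t t'"
      using finite_set_avoid[OF finT[of e], of t] by blast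
    define \<epsilon> where "\<epsilon> = min (min d1 d2) (cmod t) / 2"
    have "\<epsilon> > 0" "\<epsilon> < cmod t" "2 * \<epsilon> \<le> d2" "\<epsilon> < d1"
      using d1(1) d2(1) t(1) zero_less_norm_iff[of t] unfolding \<epsilon>_def by linarith+
    then show ?thesis using d1(2) d2(2) by (intro exI[of _ \<epsilon>]) (force simp: dist_commute)
  qed
  then have "\<forall>e t. \<exists>\<epsilon>. (e, t) \<in> I \<longrightarrow> \<epsilon> > 0 \<and> \<epsilon> < cmod t \<and> (\<forall>t'\<in>T e. t' \<noteq> t \<longrightarrow> 2 * \<epsilon> \<le> dist t t') \<and>
      (\<forall>z\<in>ball t \<epsilon>. grid_pos M \<phi> z \<notin> \<int> \<and> \<lfloor>grid_pos M \<phi> z\<rfloor> = s t)" by blast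
  then obtain \<epsilon> where "\<forall>e t. (e, t) \<in> I \<longrightarrow> \<epsilon> e t > 0 \<and> \<epsilon> e t < cmod t \<and> (\<forall>t'\<in>T e. t' \<noteq> t \<longrightarrow> 2 * \<epsilon> e t \<le> dist t t') \<and>
      (\<forall>z\<in>ball t (\<epsilon> e t). grid_pos M \<phi> z \<notin> \<int> \<and> \<lfloor>grid_pos M \<phi> z\<rfloor> = s t)"
    unfolding choice_iff by blast
  then have \<epsilon>: "\<And>e t. (e, t) \<in> I \<Longrightarrow> \<epsilon> e t > 0" "\<And>e t. (e, t) \<in> I \<Longrightarrow> \<epsilon> e t < cmod t"
      "\<And>e t t'. (e, t) \<in> I \<Longrightarrow> t' \<in> T e \<Longrightarrow> t' \<noteq> t \<Longrightarrow> 2 * \<epsilon> e t \<le> dist t t'"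
      "\<And>e t z. (e, t) \<in> I \<Longrightarrow> z \<in> ball t (\<epsilon> e t) \<Longrightarrow> grid_pos M \<phi> z \<notin> \<int>"
      "\<And>e t z. (e, t) \<in> I \<Longrightarrow> z \<in> ball t (\<epsilon> e t) \<Longrightarrow> \<lfloor>grid_pos M \<phi> z\<rfloor> = s t"
    by blast+
  define A where "A b i = (*) (b powi fst i) ` ball (snd i) (\<epsilon> (fst i) (snd i))" for b i
  define G where "G b = spec_laurent S F b" for b

  have "eventually (\<lambda>b. \<forall>i\<in>I. G b \<noteq> 0 \<and> order (snd i) (P (fst i)) \<le> (\<Sum>x\<in>{x\<in>A b i. poly (G b) x = 0}. order x (G b))) (at 0)"
    unfolding A_def G_def P_def
    by (intro eventually_ball_finite finI ballI eventually_root_cluster S \<epsilon>(1)) auto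
  moreover have "eventually (\<lambda>b. \<forall>i\<in>I. \<forall>i'\<in>I. fst i' < fst i \<longrightarrow> A b i \<inter> A b i' = {}) (at 0)"
  proof (intro eventually_ball_finite finI ballI)
    fix i i' assume "i \<in> I" "i' \<in> I"
    then show "eventually (\<lambda>b. fst i' < fst i \<longrightarrow> A b i \<inter> A b i' = {}) (at 0)"
      using eventually_clusters_disjoint[of "fst i'" "fst i" _ "snd i'"] \<epsilon>(2)[of "fst i'" "snd i'"]
      unfolding A_def by (cases "fst i' < fst i") auto
  qed
  \<comment> \<open>Needed separately because \<open>I\<close> may be empty; \<open>t\<close>,
    \<open>e\<close> and the radius are arbitrary here.\<close>
  moreover have "eventually (\<lambda>b. G b \<noteq> 0) (at 0)"
    unfolding G_def by (rule eventually_mono[OF eventually_root_cluster[where S = S and F = F and t = 0 and e = 0 and \<epsilon> = 1]])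
      (use S in auto)
  ultimately have "eventually (\<lambda>b. (\<forall>i\<in>I. order (snd i) (P (fst i)) \<le> (\<Sum>x\<in>{x\<in>A b i. poly (G b) x = 0}. order x (G b))) \<and>
     (\<forall>i\<in>I. \<forall>i'\<in>I. fst i' < fst i \<longrightarrow> A b i \<inter> A b i' = {}) \<and> G b \<noteq> 0) (at 0)"
    by eventually_elim blast
  \<comment> \<open>Only the modulus of \<open>b\<close> is restricted, so its argument remains free
    for the averaging.\<close>
  then obtain \<delta> where \<delta>: "\<delta> > 0" and small: "\<And>b. b \<noteq> 0 \<Longrightarrow> cmod b < \<delta> \<Longrightarrow>
     (\<forall>i\<in>I. order (snd i) (P (fst i)) \<le> (\<Sum>x\<in>{x\<in>A b i. poly (G b) x = 0}. order x (G b))) \<and>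
     (\<forall>i\<in>I. \<forall>i'\<in>I. fst i' < fst i \<longrightarrow> A b i \<inter> A b i' = {}) \<and> G b \<noteq> 0"
    unfolding eventually_at by auto

  \<comment> \<open>The roots of the edge polynomial per arc, with multiplicity, made
    \<open>M\<close>-periodic in \<open>i\<close> by the congruence.\<close>
  define c where "c e i = (\<Sum>t\<in>{t\<in>T e. [s t = int i] (mod int M)}. order t (P e))" for e i
  have c_sum: "(\<Sum>i<j. c e (i + h)) = (\<Sum>t\<in>{t\<in>T e. (s t - int h) mod int M < int j}. order t (P e))" if "j \<le> M" for e j h
  proof -
    have "(\<Sum>i<j. c e (i + h)) = (\<Sum>i<j. \<Sum>t\<in>T e. if [s t = int (i + h)] (mod int M) then order t (P e) else 0)"
      unfolding c_def by (simp add: sum.inter_filter[OF finT])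
    also have "\<dots> = (\<Sum>t\<in>T e. \<Sum>i<j. if [s t = int (i + h)] (mod int M) then order t (P e) else 0)"
      by (rule sum.swap)
    also have "\<dots> = (\<Sum>t\<in>T e. if (s t - int h) mod int M < int j then order t (P e) else 0)"
    proof (rule sum.cong[OF refl])
      fix t
      define m where "m = nat ((s t - int h) mod int M)"
      have m: "int m = (s t - int h) mod int M" using M0 by (simp add: m_def)
      have "[s t = int (i + h)] (mod int M) \<longleftrightarrow> i = m" if "i < j" for i
      proof -
        have "[s t = int (i + h)] (mod int M) \<longleftrightarrow> [s t - int h = int i] (mod int M)"
          by (simp add: cong_iff_dvd_diff algebra_simps)
        also have "\<dots> \<longleftrightarrow> int m = int i" using that \<open>j \<le> M\<close> by (simp add: cong_def m)
        finally show ?thesis by auto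
      qed
      then have "(\<Sum>i<j. if [s t = int (i + h)] (mod int M) then order t (P e) else 0) = (\<Sum>i<j. if i = m then order t (P e) else 0)"
        by (intro sum.cong) auto
      also have "\<dots> = (if m < j then order t (P e) else 0)" by simp
      also have "m < j \<longleftrightarrow> (s t - int h) mod int M < int j" unfolding m[symmetric] by simp
      finally show "(\<Sum>i<j. if [s t = int (i + h)] (mod int M) then order t (P e) else 0) = 
         (if (s t - int h) mod int M < int j then order t (P e) else 0)" .
    qed
    also have "\<dots> = (\<Sum>t\<in>{t\<in>T e. (s t - int h) mod int M < int j}. order t (P e))"
      by (simp add: sum.inter_filter[OF finT])
    finally show ?thesis .
  qed
  have c_total: "(\<Sum>i<M. c e (i + h)) = hi S e - lo S e" for e h
  proof -
    have "{t\<in>T e. (s t - int h) mod int M < int M} = T e" using M0 by auto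
    then show ?thesis using c_sum[of M e h] nP[of e] by (simp add: nz_root_count_def T_def)
  qed
  \<comment> \<open>The sign is negative since, after a turn by \<open>\<tau> * e\<close> arcs, arc
    \<open>i\<close> holds the roots formerly in arc \<open>i - \<tau> * e\<close>.\<close>
  define d where "d e = nat ((- e) mod int M)" for e
  have d: "int (d e) = (- e) mod int M" for e using M0 by (simp add: d_def)

  have "\<exists>\<tau><M. \<exists>j<M. (disc M (\<lambda>i. \<Sum>e\<in>E. c e (i + d e * \<tau>)) j)\<^sup>2 \<ge> real (card E) / 36"
  proof (rule exists_large_discrepancy[OF finE M(1) M0(2)])
    show "c e (j + M) = c e j" for e j
      unfolding c_def by (simp add: cong_def)
    show "0 < (\<Sum>i<M. c e i)" if "e \<in> E" for e
      using c_total[of e 0] lo_less_hi[OF S(1)] that by (simp add: E_def)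
    show "(\<Sum>i<M. c e i) < M" for e using c_total[of e 0] hiM by simp
    show "d e < M" for e using d[of e] M0 by (metis of_nat_0_less_iff of_nat_less_iff pos_mod_bound)
    show "inj_on d E"
    proof (rule inj_onI)
      fix e e' assume ee: "e \<in> E" "e' \<in> E" "d e = d e'"
      then have "[- e = - e'] (mod int M)" using d by (metis cong_def)
      then have "int M dvd e' - e" by (simp add: cong_iff_dvd_diff algebra_simps)
      moreover have "\<bar>e' - e\<bar> < int M" using eM[OF ee(1)] eM[OF ee(2)] by linarith
      ultimately show "e = e'" using zdvd_not_zless[of "\<bar>e' - e\<bar>" "int M"] by (cases "e = e'") auto
    qed
  qed
  then obtain \<tau> j where \<tau>: "\<tau> < M" and j: "j < M"
    and large: "(disc M (\<lambda>i. \<Sum>e\<in>E. c e (i + d e * \<tau>)) j)\<^sup>2 \<ge> real (card E) / 36" by blast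

  define r where "r = \<delta> / 2"
  have r: "0 < r" "r < \<delta>" using \<delta> by (auto simp: r_def)
  define b where "b = of_real r * cis (2 * pi * real \<tau> / real M)"
  have b: "b \<noteq> 0" "cmod b < \<delta>" using r by (auto simp: b_def norm_mult)
  have b_powi: "b powi e = of_real (r powi e) * cis (2 * pi * of_int (int \<tau> * e) / real M)" for e
    by (simp add: b_def power_int_mult_distrib cis_power_int mult_ac)
  note b_small = small[OF b]
  define R where "R = nonzero_roots (G b)"
  have finR: "finite R" unfolding R_def using b_small finite_nonzero_roots by blast
  have A0: "x \<noteq> 0" if x: "x \<in> A b i" and i: "i \<in> I" for x i
  proof -
    obtain z where z: "x = b powi fst i * z" "z \<in> ball (snd i) (\<epsilon> (fst i) (snd i))" using x unfolding A_def by blast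
    then have "z \<noteq> 0" using \<epsilon>(2)[of "fst i" "snd i"] i by (auto simp: dist_norm)
    then show ?thesis using z b by simp
  qed
  define \<beta> where "\<beta> = \<phi> + 2 * pi * real j / real M"
  define Q where "Q i \<longleftrightarrow> (s (snd i) + int \<tau> * fst i) mod int M < int j" for i :: "int \<times> complex"

  have disj: "disjoint_family_on (A b) I"
    unfolding disjoint_family_on_def
  proof (intro ballI impI)
    fix i i' assume i: "i \<in> I" "i' \<in> I" "i \<noteq> i'"
    show "A b i \<inter> A b i' = {}"
    proof (cases "fst i = fst i'")
      case False
      then show ?thesis using b_small i by (metis Int_commute linorder_neqE)
    next
      case True
      obtain e t t' where it: "i = (e, t)" "i' = (e, t')" using True by (metis prod.collapse)
      then have "t' \<noteq> t" "t \<in> T e" "t' \<in> T e" using i by (auto simp: I_def)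
      then have "2 * \<epsilon> e t \<le> dist t t'" "2 * \<epsilon> e t' \<le> dist t t'"
        using \<epsilon>(3)[of e t t'] \<epsilon>(3)[of e t' t] i it by (auto simp: dist_commute)
      then have "\<epsilon> e t + \<epsilon> e t' \<le> dist t t'" by linarith
      then have "ball t (\<epsilon> e t) \<inter> ball t' (\<epsilon> e t') = {}" by (rule disjoint_ballI)
      moreover have "inj ((*) (b powi e))" using b by (simp add: inj_on_def)
      ultimately show ?thesis unfolding A_def it by (simp add: image_Int[symmetric])
    qed
  qed
  have lower: "order (snd i) (P (fst i)) \<le> (\<Sum>x\<in>R \<inter> A b i. order x (G b))" if "i \<in> I" for i
  proof -
    have "{x\<in>A b i. poly (G b) x = 0} = R \<inter> A b i" using A0[OF _ that] by (auto simp: R_def nonzero_roots_def)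
    then show ?thesis using b_small that by auto
  qed
  have sumI: "(\<Sum>i\<in>I. order (snd i) (P (fst i))) = (\<Sum>e\<in>E. hi S e - lo S e)"
  proof -
    have "(\<Sum>i\<in>I. order (snd i) (P (fst i))) = (\<Sum>e\<in>E. \<Sum>t\<in>T e. order t (P e))"
      unfolding I_def using finE finT by (simp add: sum.Sigma case_prod_unfold)
    then show ?thesis using nP by (simp add: nz_root_count_def T_def)
  qed
  \<comment> \<open>The exponents of \<open>x\<close> bound the number of nonzero roots by the width
    of the support, which is the sum of the edge widths.\<close>
  have total: "(\<Sum>x\<in>R. order x (G b)) \<le> (\<Sum>i\<in>I. order (snd i) (P (fst i)))"
    using nz_root_count_spec_laurent_le[OF S(1), of F b] b_small sum_slopes_width[OF S(1,2) int] sumI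
    by (simp add: G_def R_def nz_root_count_def E_def)
  \<comment> \<open>The factor \<open>b powi e\<close> turns by exactly \<open>\<tau> * e\<close>
    arcs, and \<open>z\<close> shares the arc of \<open>t\<close>.\<close>
  have sector: "\<phi> \<le> arg02pi x \<and> arg02pi x \<le> \<beta> \<longleftrightarrow> Q i" if i: "i \<in> I" and x: "x \<in> A b i" for i x
  proof -
    obtain e t where et: "i = (e, t)" by force
    obtain z where z: "x = b powi e * z" "z \<in> ball t (\<epsilon> e t)" using x unfolding A_def et fst_conv snd_conv by blast
    have z0: "z \<noteq> 0" using z A0[OF x i] by auto
    have x_eq: "x = of_real (r powi e) * cis (2 * pi * of_int (int \<tau> * e) / real M) * z"
      using z b_powi by simp
    have rp: "r powi e > 0" using r by simp
    note rot = floor_grid_pos_rotate[OF z0 rp M0(1), of \<phi> "int \<tau> * e", folded x_eq]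
    have "grid_pos M \<phi> x \<notin> \<int>" using rot(2) \<epsilon>(4)[of e t z] i z et by simp
    moreover have "\<lfloor>grid_pos M \<phi> x\<rfloor> = (s t + int \<tau> * e) mod int M" using rot(1) \<epsilon>(5)[of e t z] i z et by simp
    ultimately show ?thesis using arg_interval_iff_grid_pos[OF A0[OF x i] _ \<phi> j] by (simp add: \<beta>_def Q_def et)
  qed

  have "N_arg \<phi> \<beta> (G b) = (\<Sum>i\<in>{i\<in>I. Q i}. order (snd i) (P (fst i)))"
    unfolding N_arg_def R_def[symmetric]
    by (rule sum_clusters_eq[OF finR finI disj lower total sector])
  also have "\<dots> = (\<Sum>e\<in>E. \<Sum>t\<in>{t\<in>T e. Q (e, t)}. order t (P e))"
  proof -
    have "{i\<in>I. Q i} = Sigma E (\<lambda>e. {t\<in>T e. Q (e, t)})" by (auto simp: I_def)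
    then show ?thesis using finE finT by (simp add: sum.Sigma case_prod_unfold)
  qed
  also have "\<dots> = (\<Sum>e\<in>E. \<Sum>i<j. c e (i + d e * \<tau>))"
  proof (rule sum.cong[OF refl])
    fix e
    have "(s t - int (d e * \<tau>)) mod int M = (s t + int \<tau> * e) mod int M" for t
    proof -
      have "[int (d e) = - e] (mod int M)" by (simp add: d cong_def)
      then have "[s t - int (d e) * int \<tau> = s t - (- e) * int \<tau>] (mod int M)"
        by (intro cong_diff cong_mult cong_refl)
      then show ?thesis by (simp add: cong_def algebra_simps)
    qed
    then show "(\<Sum>t\<in>{t\<in>T e. Q (e, t)}. order t (P e)) = (\<Sum>i<j. c e (i + d e * \<tau>))"
      using c_sum[of j e "d e * \<tau>"] j by (simp add: Q_def)
  qed
  finally have N: "N_arg \<phi> \<beta> (G b) = (\<Sum>i<j. \<Sum>e\<in>E. c e (i + d e * \<tau>))"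
    by (simp add: sum.swap[of _ E])
  \<comment> \<open>The trivial sector, all of the plane, gives the total count.\<close>
  have "nz_root_count (G b) = (\<Sum>i\<in>I. order (snd i) (P (fst i)))"
    using sum_clusters_eq[OF finR finI disj lower total, of "\<lambda>_. True" "\<lambda>_. True"]
    by (simp add: nz_root_count_def R_def)
  also have "\<dots> = (\<Sum>e\<in>E. \<Sum>i<M. c e (i + d e * \<tau>))" by (simp add: sumI c_total)
  finally have nz: "nz_root_count (G b) = (\<Sum>i<M. \<Sum>e\<in>E. c e (i + d e * \<tau>))"
    by (simp add: sum.swap[of _ E])
  have "disc M (\<lambda>i. \<Sum>e\<in>E. c e (i + d e * \<tau>)) j = real (N_arg \<phi> \<beta> (G b)) - real (nz_root_count (G b)) * (\<beta> - \<phi>) / (2 * pi)"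
    unfolding disc_def N nz by (simp add: \<beta>_def)
  moreover have "\<beta> \<le> 2 * pi"
  proof -
    have "\<beta> \<le> 2 * pi / real M + 2 * pi * real j / real M" using \<phi> by (simp add: \<beta>_def)
    also have "\<dots> = 2 * pi * (real j + 1) / real M" by (simp add: add_divide_distrib algebra_simps)
    also have "\<dots> \<le> 2 * pi * real M / real M" using j M0 by (intro divide_right_mono mult_left_mono) auto
    finally show ?thesis using M0 by simp
  qed
  moreover have "\<phi> \<le> \<beta>" by (simp add: \<beta>_def)
  ultimately have "\<bar>disc M (\<lambda>i. \<Sum>e\<in>E. c e (i + d e * \<tau>)) j\<bar> \<le> bias (G b)"
    using bias_ge[of "G b" \<phi> \<beta>] b_small \<phi>(1) by simp
  moreover have "sqrt (real (card E) / 36) \<le> \<bar>disc M (\<lambda>i. \<Sum>e\<in>E. c e (i + d e * \<tau>)) j\<bar>"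
    using real_sqrt_le_mono[OF large] by simp
  moreover have "sqrt (real (card E) / 36) = sqrt (real (card E)) / 6"
    by (simp add: real_sqrt_divide real_sqrt_eq_iff)
  ultimately show ?thesis using b b_small unfolding G_def E_def by (intro exI[of _ b]) auto
qed

section \<open>Vertices of the Newton polygon\<close>

text \<open>The lower vertices for \<open>\<sigma> = 1\<close> and the upper vertices for \<open>\<sigma> = - 1\<close>.\<close>

definition side_vertices :: "int \<Rightarrow> (nat \<times> nat) set \<Rightarrow> (nat \<times> nat) set" where
  "side_vertices \<sigma> S = {p\<in>S. \<exists>l::real. \<forall>q\<in>S - {p}.
     of_int \<sigma> * real (snd p) + l * real (fst p) < of_int \<sigma> * real (snd q) + l * real (fst q)}"

text \<open>Reflecting heights by \<sigma> and stretching them by \<open>Q\<close> reduces this to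
  lower vertices with integral slopes. The loss of 1 is the leftmost vertex, which is the right end
  of no edge.\<close>

lemma exists_large_bias_spec_y:
  assumes F: "is_bipoly F" "supp2 F \<noteq> {}" and \<sigma>: "\<sigma> \<in> {1, - 1}"
  shows "\<exists>a. a \<noteq> 0 \<and> spec_y F a \<noteq> 0 \<and>
    sqrt (real (card (side_vertices \<sigma> (supp2 F)) - 1)) / 6 \<le> bias (spec_y F a)"
proof -
  define S where "S = supp2 F"
  have S: "finite S" "S \<noteq> {}" using F by (auto simp: S_def is_bipoly_def)
  \<comment> \<open>Differences of abscissae do not exceed the largest abscissa, so they divide this
    factorial.\<close>
  define Q :: nat where "Q = fact (Max (fst ` S))"
  have Q: "Q > 0" by (simp add: Q_def)
  define f where "f p = (fst p, \<sigma> * int Q * int (snd p))" for p :: "nat \<times> nat"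
  have "inj f" using Q \<sigma> by (auto simp: inj_def f_def prod_eq_iff)
  define F' where "F' = F \<circ> inv f"
  have F': "F' (f p) = F p" for p using \<open>inj f\<close> by (simp add: F'_def)
  have nz: "F' p \<noteq> 0" if "p \<in> f ` S" for p using that F' by (auto simp: S_def supp2_def)
  have "integral_slopes (f ` S)"
    unfolding integral_slopes_def
  proof (intro ballI impI)
    fix p' q' assume "p' \<in> f ` S" "q' \<in> f ` S" and ne: "fst p' \<noteq> fst q'"
    then obtain p q where pq: "p \<in> S" "q \<in> S" "p' = f p" "q' = f q" by auto
    have "fst p \<le> Max (fst ` S)" "fst q \<le> Max (fst ` S)" using S pq by auto
    then have "nat \<bar>int (fst q) - int (fst p)\<bar> \<le> Max (fst ` S)" by linarith
    moreover have "1 \<le> nat \<bar>int (fst q) - int (fst p)\<bar>" using ne pq by (simp add: f_def)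
    ultimately have "nat \<bar>int (fst q) - int (fst p)\<bar> dvd Q" unfolding Q_def by (rule dvd_fact[rotated])
    then have "int (fst q) - int (fst p) dvd int Q" by (metis abs_dvd_iff int_dvd_int_iff nat_0_le abs_ge_zero)
    moreover have "snd p' - snd q' = int Q * (\<sigma> * (int (snd p) - int (snd q)))" by (simp add: pq f_def algebra_simps)
    ultimately show "int (fst q') - int (fst p') dvd snd p' - snd q'" using pq by (simp add: f_def)
  qed
  moreover have "f ` side_vertices \<sigma> S \<subseteq> lower_vertices (f ` S)"
  proof
    fix v' assume "v' \<in> f ` side_vertices \<sigma> S"
    then obtain v l where v: "v' = f v" "v \<in> S" and l: "\<And>q. q \<in> S - {v} \<Longrightarrow>
        of_int \<sigma> * real (snd v) + l * real (fst v) < of_int \<sigma> * real (snd q) + l * real (fst q)"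
      unfolding side_vertices_def by blast
    have "of_int (snd v') + (real Q * l) * real (fst v') < of_int (snd q') + (real Q * l) * real (fst q')"
      if "q' \<in> f ` S - {v'}" for q'
    proof -
      obtain q where q: "q' = f q" "q \<in> S - {v}" using \<open>q' \<in> f ` S - {v'}\<close> v by auto
      have "real Q * (of_int \<sigma> * real (snd v) + l * real (fst v)) < real Q * (of_int \<sigma> * real (snd q) + l * real (fst q))"
        using l[OF q(2)] Q by simp
      then show ?thesis by (simp add: q v f_def algebra_simps)
    qed
    then show "v' \<in> lower_vertices (f ` S)" unfolding lower_vertices_def using v by blast
  qed
  then have "card (side_vertices \<sigma> S) \<le> card (lower_vertices (f ` S))"
    using \<open>inj f\<close> S by (intro card_inj_on_le[of f]) (auto simp: inj_on_def inj_def lower_vertices_def)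
  moreover note card_lower_vertices[of "f ` S"]
  ultimately have "card (side_vertices \<sigma> S) - 1 \<le> card (slopes (f ` S))" using S by fastforce
  moreover obtain b where b: "b \<noteq> 0" "spec_laurent (f ` S) F' b \<noteq> 0"
      "sqrt (real (card (slopes (f ` S)))) / 6 \<le> bias (spec_laurent (f ` S) F' b)"
    using exists_large_bias[of "f ` S" F'] S nz \<open>integral_slopes (f ` S)\<close> by auto
  \<comment> \<open>The parameter \<open>a\<close> is a power of \<open>b\<close>, so no root is
    extracted; for \<open>\<sigma> = - 1\<close> small \<open>b\<close> means large
    \<open>a\<close>.\<close>
  moreover have "spec_laurent (f ` S) F' b = spec_y F (b powi (\<sigma> * int Q))"
    unfolding spec_laurent_def spec_y_def S_def[symmetric]
    using \<open>inj f\<close> by (subst sum.reindex) (auto simp: inj_on_def inj_def F' f_def power_int_mult simp flip: F')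
  ultimately show ?thesis
    by (intro exI[of _ "b powi (\<sigma> * int Q)"]) (auto simp: S_def[symmetric] elim!: order_trans[rotated])
qed

text \<open>Vertices of a polytope are exposed, so a linear functional singles each of them out; the
  sign of its second coefficient decides between the lower and the upper side.\<close>

lemma extreme_points_newt_subset:
  assumes "is_bipoly F"
  shows "{v. v extreme_point_of newt F} \<subseteq>
    (\<lambda>(i, j). (real i, real j)) ` (side_vertices 1 (supp2 F) \<union> side_vertices (- 1) (supp2 F))"
proof
  let ?\<iota> = "\<lambda>(i, j). (real i, real j)"
  define S where "S = supp2 F"
  have S: "finite S" using assms by (simp add: S_def is_bipoly_def)
  have N: "newt F = convex hull (?\<iota> ` S)" by (simp add: newt_def S_def)
  fix v assume v: "v \<in> {v. v extreme_point_of newt F}"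
  then have "v \<in> ?\<iota> ` S" using extreme_point_of_convex_hull by (auto simp: N)
  then obtain p where p: "p \<in> S" "v = ?\<iota> p" by blast
  have "polyhedron (newt F)" unfolding N using S by (simp add: polyhedron_convex_hull)
  moreover have "{v} face_of newt F" using v by (simp add: face_of_singleton)
  ultimately have "{v} exposed_face_of newt F" using exposed_face_of_polyhedron by blast
  then obtain c d where cd: "newt F \<subseteq> {x. c \<bullet> x \<le> d}" "{v} = newt F \<inter> {x. c \<bullet> x = d}"
    unfolding exposed_face_of_def by blast
  obtain \<alpha> \<beta> where c: "c = (\<alpha>, \<beta>)" by force
  have less: "\<alpha> * real (fst q) + \<beta> * real (snd q) < \<alpha> * real (fst p) + \<beta> * real (snd p)" if "q \<in> S - {p}" for q
  proof -
    have "?\<iota> q \<in> newt F" unfolding N using that by (intro hull_inc) auto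
    moreover have "?\<iota> q \<noteq> v" using that p by (auto simp: split_beta prod_eq_iff)
    ultimately have "c \<bullet> ?\<iota> q < d" using cd by force
    moreover have "c \<bullet> v = d" using cd by blast
    ultimately show ?thesis using p by (simp add: c split_beta)
  qed
  have side: "p \<in> side_vertices \<sigma> S" if "\<And>q. q \<in> S - {p} \<Longrightarrow>
      of_int \<sigma> * real (snd p) + l * real (fst p) < of_int \<sigma> * real (snd q) + l * real (fst q)" for \<sigma> l
    using p(1) that unfolding side_vertices_def by blast
  have "p \<in> side_vertices 1 S \<union> side_vertices (- 1) S"
  proof (cases \<beta> "0 :: real" rule: linorder_cases)
    case equal
    \<comment> \<open>A vertical supporting line is tilted. Other points differ in abscissa by at
      least 1, so slope \<open>snd p + 1\<close> outweighs any drop in height, which is at most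
      \<open>snd p\<close>.\<close>
    define l where "l = - sgn \<alpha> * (real (snd p) + 1)"
    have "real (snd p) + l * real (fst p) < real (snd q) + l * real (fst q)" if "q \<in> S - {p}" for q
    proof -
      have "\<alpha> * (real (fst q) - real (fst p)) < 0" using less[OF that] equal by (simp add: algebra_simps)
      then have "- sgn \<alpha> * (real (fst q) - real (fst p)) \<ge> 1"
        by (auto simp: mult_less_0_iff)
      then have "(real (snd p) + 1) * 1 \<le> (real (snd p) + 1) * (- sgn \<alpha> * (real (fst q) - real (fst p)))"
        by (intro mult_left_mono) auto
      then have "real (snd p) + 1 \<le> l * (real (fst q) - real (fst p))" by (simp add: l_def mult_ac)
      then show ?thesis by (simp add: algebra_simps)
    qed
    then show ?thesis by (intro UnI1 side[of 1 l]) simp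
  next
    case less': less
    have "real (snd p) + (\<alpha> / \<beta>) * real (fst p) < real (snd q) + (\<alpha> / \<beta>) * real (fst q)" if "q \<in> S - {p}" for q
      using divide_strict_right_mono_neg[OF less[OF that] less'] less' by (simp add: add_divide_distrib)
    then show ?thesis by (intro UnI1 side[of 1 "\<alpha> / \<beta>"]) simp
  next
    case greater
    have "- real (snd p) + (- \<alpha> / \<beta>) * real (fst p) < - real (snd q) + (- \<alpha> / \<beta>) * real (fst q)" if "q \<in> S - {p}" for q
      using divide_strict_right_mono[OF less[OF that] greater] greater by (simp add: add_divide_distrib)
    then show ?thesis by (intro UnI2 side[of "- 1" "- \<alpha> / \<beta>"]) simp
  qed
  then show "v \<in> ?\<iota> ` (side_vertices 1 (supp2 F) \<union> side_vertices (- 1) (supp2 F))"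
    using p by (simp add: S_def)
qed

theorem theorem2p2:
  shows "\<exists>(c::real) (k0::nat). c > 0 \<and>
    (\<forall>k\<ge>k0. \<forall>F :: nat \<times> nat \<Rightarrow> complex.
       is_bipoly F \<and> num_vertices (newt F) = k \<longrightarrow>
       (\<exists>a::complex. a \<noteq> 0 \<and> spec_y F a \<noteq> 0 \<and> bias (spec_y F a) \<ge> c * sqrt (real k)))"
\<comment> \<open>One side has at least \<open>k / 2\<close> vertices, hence at least
  \<open>k / 2 - 1\<close> edges, which is at least \<open>k / 4\<close> once
  \<open>k \<ge> 4\<close>. The factor 1/12 is 1/6 times \<open>sqrt (1 / 4)\<close>.\<close>
proof (intro exI[of _ "1 / 12 :: real"] exI[of _ "4 :: nat"] conjI allI impI)
  fix k :: nat and F :: "nat \<times> nat \<Rightarrow> complex"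
  assume k: "4 \<le> k" and F: "is_bipoly F \<and> num_vertices (newt F) = k"
  let ?V = "\<lambda>\<sigma>. side_vertices \<sigma> (supp2 F)"
  have fin: "finite (?V \<sigma>)" for \<sigma> using F by (simp add: side_vertices_def is_bipoly_def)
  have "k \<le> card ((\<lambda>(i, j). (real i, real j)) ` (?V 1 \<union> ?V (- 1)))"
    using F extreme_points_newt_subset fin by (auto simp: num_vertices_def intro!: card_mono)
  also have "\<dots> \<le> card (?V 1 \<union> ?V (- 1))" using fin by (intro card_image_le) auto
  also have "\<dots> \<le> card (?V 1) + card (?V (- 1))" by (rule card_Un_le)
  finally have "k \<le> 2 * card (?V 1) \<or> k \<le> 2 * card (?V (- 1))" by linarith
  then obtain \<sigma> :: int where \<sigma>: "\<sigma> \<in> {1, - 1}" "k \<le> 2 * card (?V \<sigma>)" by blast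
  then have "?V \<sigma> \<noteq> {}" using k by force
  then have "supp2 F \<noteq> {}" by (auto simp: side_vertices_def)
  then obtain a where a: "a \<noteq> 0" "spec_y F a \<noteq> 0" "sqrt (real (card (?V \<sigma>) - 1)) / 6 \<le> bias (spec_y F a)"
    using exists_large_bias_spec_y F \<sigma>(1) by blast
  have "real k / 4 \<le> real (card (?V \<sigma>) - 1)" using \<sigma>(2) k by linarith
  then have "sqrt (real k / 4) \<le> sqrt (real (card (?V \<sigma>) - 1))" by (rule real_sqrt_le_mono)
  then have "1 / 12 * sqrt (real k) \<le> bias (spec_y F a)" using a(3) by (simp add: real_sqrt_divide)
  then show "\<exists>a. a \<noteq> 0 \<and> spec_y F a \<noteq> 0 \<and> 1 / 12 * sqrt (real k) \<le> bias (spec_y F a)" using a by blast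
qed simp

end
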